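(* Let $(G_1,d_{G_1})$ and $(G_2,d_{G_2})$ be two metric graphs. Then the persistence-distortion distance and the Gromov-Hausdorff distance satisfy $$\mathrm{d_{PD}}(G_1,G_2)\le 6\,\mathrm{d_{GH}}(G_1,G_2).$$ Consequently, for any metric graphs $G_1,G_2$ and metric graphs $G_1',G_2'$ (perturbations of $G_1$ and $G_2$, respectively), $$\mathrm{d_{PD}}(G_1',G_2')\le \mathrm{d_{PD}}(G_1,G_2)+6\,\mathrm{d_{GH}}(G_1,G_1')+6\,\mathrm{d_{GH}}(G_2,G_2').$$
   Context: Metric graph: a finite connected graph $G=(V,E)$ with a length function $\mathrm{Len}:E\to\mathbb{R}_{>0}$, identified with its geometric realization, in which each edge $e$ is an arc of length $\mathrm{Len}(e)$ (parametrized by arc length); $d_G(z,w)$ is the minimum length of a path between $z$ and $w$, for any two points $z,w$ of the realization (not only nodes). Persistence diagram: for a continuous $f:G\to\mathbb{R}$, $\mathrm{Dg}_0(f)$ is the 0-dimensional persistence diagram of the filtration by superlevel sets $G^\alpha=\{x: f(x)\ge\alpha\}$ as $\alpha$ decreases. It is a multiset of points $(b,d)\in\mathbb{R}^2$, $d<b$, each recording that a connected component is created at time $b$ (at a local maximum of value $b$) and at time $d$ merges with a component created earlier (elder rule). The component that never merges into an earlier one contributes no point. Bottleneck distance: for finite diagrams $D,D'$ and the diagonal $L=\{(x,x)\}\subset\mathbb{R}^2$, a partial matching matches each point of $D$ either to a unique point of $D'$ or to its $L_\infty$-closest point of $L$, and likewise each point of $D'$ is matched either to a unique point of $D$ or to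 its closest point of $L$. $d_B(D,D')$ is the minimum over partial matchings $C$ of $\max_{(p,q)\in C}\|p-q\|_\infty$. For $\mathbf{s}\in G_1$ put $d_{G_1,\mathbf{s}}(x)=d_{G_1}(\mathbf{s},x)$ and $P_{\mathbf{s}}=\mathrm{Dg}_0(d_{G_1,\mathbf{s}})$; for $\mathbf{t}\in G_2$ put $Q_{\mathbf{t}}=\mathrm{Dg}_0(d_{G_2,\mathbf{t}})$. Let $\mathcal{C}=\{P_{\mathbf{s}}:\mathbf{s}\in G_1\}$, $\mathcal{F}=\{Q_{\mathbf{t}}:\mathbf{t}\in G_2\}$ (basepoints range over all points of the graphs). The persistence-distortion distance is the Hausdorff distance $$\mathrm{d_{PD}}(G_1,G_2)=\max\{\max_{P\in\mathcal{C}}\min_{Q\in\mathcal{F}}d_B(P,Q),\ \max_{Q\in\mathcal{F}}\min_{P\in\mathcal{C}}d_B(P,Q)\}.$$ Gromov-Hausdorff distance: $\mathrm{d_{GH}}(X,Y)=\frac12\inf_{\mathcal{M}}\max_{(x_1,y_1),(x_2,y_2)\in\mathcal{M}}|d_X(x_1,x_2)-d_Y(y_1,y_2)|$, over all correspondences $\mathcal{M}\subseteq X\times Y$ (relations whose projections to $X$ and to $Y$ are both surjective). *)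

theory Defs
  imports
    "HOL-Analysis.Analysis"
    "HOL-Library.Multiset"
    "Graph_Theory.Digraph_Component"
begin

(* It would otherwise hide the topological notion. *)
hide_const (open) Digraph_Component.connected

section \<open>Metric graphs and their geometric realization\<close>

text \<open>
  The underlying undirected graph is given by a digraph with labelled arcs in which every edge
  occurs exactly once, with an arbitrarily chosen direction; the direction only fixes an arc-length
  parametrization of the edge, starting at its tail.  Loops and parallel edges are allowed.
\<close>

record ('v, 'e) len_graph =
  underlying :: "('v, 'e) pre_digraph"
  len :: "'e \<Rightarrow> real"

definition metric_graph :: "('v, 'e) len_graph \<Rightarrow> bool" where
  "metric_graph G \<longleftrightarrow>
     fin_digraph (underlying G) \<and> Digraph_Component.connected (underlying G) \<and>
     (\<forall>e\<in>arcs (underlying G). len G e > 0)"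

datatype ('v, 'e) point = Node 'v | Inner 'e real

definition points :: "('v, 'e) len_graph \<Rightarrow> ('v, 'e) point set" where
  "points G = Node ` verts (underlying G) \<union>
     {Inner e t | e t. e \<in> arcs (underlying G) \<and> 0 < t \<and> t < len G e}"

text \<open>The point of the closed edge \<open>e\<close> at arc length \<open>t\<close> from its tail, for \<open>0 \<le> t \<le> len G e\<close>.\<close>

definition edge_point :: "('v, 'e) len_graph \<Rightarrow> 'e \<Rightarrow> real \<Rightarrow> ('v, 'e) point" where
  "edge_point G e t =
     (if t = 0 then Node (tail (underlying G) e)
      else if t = len G e then Node (head (underlying G) e)
      else Inner e t)"

text \<open>
  \<open>gpath G p q l\<close>: some path from \<open>p\<close> to \<open>q\<close> has length \<open>l\<close>.  Paths are finite concatenations of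
  segments, each contained in a single closed edge; they may start and end in the interior of edges.
\<close>

inductive gpath ::
  "('v, 'e) len_graph \<Rightarrow> ('v, 'e) point \<Rightarrow> ('v, 'e) point \<Rightarrow> real \<Rightarrow> bool" for G where
  refl: "p \<in> points G \<Longrightarrow> gpath G p p 0"
| step: "\<lbrakk>e \<in> arcs (underlying G); s \<in> {0..len G e}; t \<in> {0..len G e}; gpath G (edge_point G e t) q l\<rbrakk>
    \<Longrightarrow> gpath G (edge_point G e s) q (\<bar>s - t\<bar> + l)"

text \<open>The value outside \<open>points G\<close> is irrelevant; it is what \<open>Metric_space\<close> asks for.\<close>

definition gdist :: "('v, 'e) len_graph \<Rightarrow> ('v, 'e) point \<Rightarrow> ('v, 'e) point \<Rightarrow> real" where
  "gdist G p q = (if p \<in> points G \<and> q \<in> points G then Inf {l. gpath G p q l} else 0)"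

definition gtopology :: "('v, 'e) len_graph \<Rightarrow> ('v, 'e) point topology" where
  "gtopology G = Metric_space.mtopology (points G) (gdist G)"

lemma edge_point_in_points:
  assumes "metric_graph G" "e \<in> arcs (underlying G)" "s \<in> {0..len G e}"
  shows "edge_point G e s \<in> points G"
proof -
  interpret fin_digraph "underlying G" using assms(1) by (simp add: metric_graph_def)
  show ?thesis using assms(2,3) by (auto simp: edge_point_def points_def)
qed

lemma gpath_in_points:
  assumes "gpath G p q l" "metric_graph G"
  shows "p \<in> points G" "q \<in> points G"
  using assms by (induction) (auto intro: edge_point_in_points)

lemma gpath_nonneg: "gpath G p q l \<Longrightarrow> 0 \<le> l"
  by (induction rule: gpath.induct) auto

lemma gpath_trans: "gpath G p q l \<Longrightarrow> gpath G q r l' \<Longrightarrow> gpath G p r (l + l')"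
proof (induction arbitrary: l' rule: gpath.induct)
  case (step e s t q l)
  from gpath.step[OF step.hyps(1-3) step.IH[OF step.prems]] show ?case
    by (simp add: add.assoc)
qed auto

lemma gpath_segment:
  assumes "metric_graph G" "e \<in> arcs (underlying G)" "s \<in> {0..len G e}" "t \<in> {0..len G e}"
  shows "gpath G (edge_point G e s) (edge_point G e t) \<bar>s - t\<bar>"
  using gpath.step[OF assms(2-4) gpath.refl[OF edge_point_in_points[OF assms(1,2,4)]]] by simp

lemma gpath_sym: "gpath G p q l \<Longrightarrow> metric_graph G \<Longrightarrow> gpath G q p l"
proof (induction rule: gpath.induct)
  case (step e s t q l)
  from gpath_trans[OF step.IH[OF step.prems] gpath_segment[OF step.prems step.hyps(1,3,2)]]
  show ?case by (simp add: abs_minus_commute add.commute)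
qed (rule gpath.refl)

lemma gpath_to_node:
  assumes G: "metric_graph G" and p: "p \<in> points G"
  shows "\<exists>v\<in>verts (underlying G). \<exists>l. gpath G p (Node v) l"
proof (cases p)
  case (Node v)
  with p gpath.refl[OF p] show ?thesis by (auto simp: points_def)
next
  case (Inner e t)
  interpret fin_digraph "underlying G" using G by (simp add: metric_graph_def)
  from Inner p have e: "e \<in> arcs (underlying G)" and t: "0 < t" "t < len G e"
    by (auto simp: points_def)
  from gpath_segment[OF G e, of t 0] t Inner have "gpath G p (Node (tail (underlying G) e)) t"
    by (auto simp: edge_point_def)
  with e show ?thesis by (auto intro!: bexI[of _ "tail (underlying G) e"])
qed

lemma gpath_nodes:
  assumes G: "metric_graph G" and uv: "u \<in> verts (underlying G)" "v \<in> verts (underlying G)"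
  shows "\<exists>l. gpath G (Node u) (Node v) l"
proof -
  interpret fin_digraph "underlying G" using G by (simp add: metric_graph_def)
  have "(u, v) \<in> rtrancl_on (verts (underlying G)) (arcs_ends (mk_symmetric (underlying G)))"
    using G uv by (auto simp: metric_graph_def Digraph_Component.connected_def
        strongly_connected_def reachable_def)
  then show ?thesis
  proof (induction rule: rtrancl_on_induct)
    case base
    then show ?case by (auto intro!: exI gpath.refl simp: points_def)
  next
    case (step v w)
    then obtain l where l: "gpath G (Node u) (Node v) l" by auto
    from step(2) have "(v, w) \<in> arcs_ends (underlying G) \<or> (w, v) \<in> arcs_ends (underlying G)"
      by (auto simp: arcs_ends_def arc_to_ends_def parcs_mk_symmetric)
    then obtain e where e: "e \<in> arcs (underlying G)"
      "(v = tail (underlying G) e \<and> w = head (underlying G) e) \<or> (w = tail (underlying G) e \<and> v = head (underlying G) e)"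
      by (auto simp: arcs_ends_conv)
    have pos: "len G e > 0" using G e(1) by (auto simp: metric_graph_def)
    have th: "gpath G (Node (tail (underlying G) e)) (Node (head (underlying G) e)) (len G e)"
      using gpath_segment[OF G e(1), of 0 "len G e"] pos by (auto simp: edge_point_def)
    have "gpath G (Node v) (Node w) (len G e)"
      using e(2) th gpath_sym[OF th G] by auto
    from gpath_trans[OF l this] show ?case by auto
  qed
qed

lemma gpath_exists:
  assumes G: "metric_graph G" and pq: "p \<in> points G" "q \<in> points G"
  shows "\<exists>l. gpath G p q l"
proof -
  obtain u l where u: "u \<in> verts (underlying G)" "gpath G p (Node u) l"
    using gpath_to_node[OF G pq(1)] by auto
  obtain v l' where v: "v \<in> verts (underlying G)" "gpath G q (Node v) l'"
    using gpath_to_node[OF G pq(2)] by auto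
  obtain m where "gpath G (Node u) (Node v) m" using gpath_nodes[OF G u(1) v(1)] by auto
  with gpath_trans[OF gpath_trans[OF u(2)] gpath_sym[OF v(2) G]] show ?thesis by blast
qed

lemma gpath_lipschitz:
  assumes "gpath G p q l"
    and "\<And>e s t. \<lbrakk>e \<in> arcs (underlying G); s \<in> {0..len G e}; t \<in> {0..len G e}\<rbrakk>
           \<Longrightarrow> \<bar>\<phi> (edge_point G e s) - \<phi> (edge_point G e t)\<bar> \<le> \<bar>s - t\<bar>"
  shows "\<bar>\<phi> p - \<phi> q\<bar> \<le> l"
  using assms
proof (induction rule: gpath.induct)
  case (step e s t q l)
  have "\<bar>\<phi> (edge_point G e s) - \<phi> (edge_point G e t)\<bar> \<le> \<bar>s - t\<bar>"
    using step.prems step.hyps by blast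
  moreover have "\<bar>\<phi> (edge_point G e t) - \<phi> q\<bar> \<le> l" using step by blast
  ultimately show ?case by linarith
qed simp

lemma gpath_length_lower_bound:
  assumes G: "metric_graph G" and pq: "p \<in> points G" "q \<in> points G" "p \<noteq> q"
  shows "\<exists>\<delta>>0. \<forall>l. gpath G p q l \<longrightarrow> \<delta> \<le> l"
proof -
  have "\<exists>\<phi>. \<phi> q < \<phi> p \<and> (\<forall>e s t. e \<in> arcs (underlying G) \<longrightarrow> s \<in> {0..len G e} \<longrightarrow> t \<in> {0..len G e}
      \<longrightarrow> \<bar>\<phi> (edge_point G e s) - \<phi> (edge_point G e t)\<bar> \<le> \<bar>s - t\<bar>)"
  proof (cases p)
    case (Inner e0 t0)
    from Inner pq have t0: "0 < t0" "t0 < len G e0" by (auto simp: points_def)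
    define r where "r = min t0 (len G e0 - t0)"
    define \<phi> where "\<phi> x = (case x of Node v \<Rightarrow> 0
       | Inner e s \<Rightarrow> if e = e0 then max 0 (r - \<bar>s - t0\<bar>) else 0)" for x :: "('a, 'b) point"
    have r: "r > 0" using t0 by (auto simp: r_def)
    have ep: "\<phi> (edge_point G e s) = (if e = e0 then max 0 (r - \<bar>s - t0\<bar>) else 0)"
      if "s \<in> {0..len G e}" for e s
      using that t0 by (auto simp: \<phi>_def edge_point_def r_def)
    have "\<phi> q < \<phi> p"
      using pq(3) r Inner by (auto simp: \<phi>_def split: point.splits)
    then show ?thesis by (intro exI[of _ \<phi>]) (auto simp: ep)
  next
    case (Node v)
    have fin: "finite (arcs (underlying G))"
      using G by (auto simp: metric_graph_def fin_digraph_def fin_digraph_axioms_def)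
    define r where "r = Min (insert 1 (len G ` arcs (underlying G)))"
    have r: "r > 0" using G fin by (auto simp: r_def metric_graph_def)
    have rl: "r \<le> len G e" if "e \<in> arcs (underlying G)" for e
      using that fin by (auto simp: r_def)
    define h where "h e s =
       max (if tail (underlying G) e = v then max 0 (r - s) else 0)
           (if head (underlying G) e = v then max 0 (r - (len G e - s)) else 0)" for e s
    define \<phi> where "\<phi> x = (case x of Node u \<Rightarrow> if u = v then r else 0
       | Inner e s \<Rightarrow> h e s)" for x :: "('a, 'b) point"
    have ep: "\<phi> (edge_point G e s) = h e s"
      if "e \<in> arcs (underlying G)" "s \<in> {0..len G e}" for e s
      using that rl[of e] r by (auto simp: \<phi>_def edge_point_def h_def)
    have "\<phi> q < \<phi> p"
      using pq Node r by (auto simp: \<phi>_def h_def points_def split: if_splits)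
    then show ?thesis by (intro exI[of _ \<phi>]) (auto simp: ep h_def max_def abs_if)
  qed
  then obtain \<phi> where lt: "\<phi> q < \<phi> p" and lip:
    "\<And>e s t. \<lbrakk>e \<in> arcs (underlying G); s \<in> {0..len G e}; t \<in> {0..len G e}\<rbrakk>
           \<Longrightarrow> \<bar>\<phi> (edge_point G e s) - \<phi> (edge_point G e t)\<bar> \<le> \<bar>s - t\<bar>"
    by blast
  show ?thesis
  proof (intro exI[of _ "\<phi> p - \<phi> q"] conjI allI impI)
    fix l assume "gpath G p q l"
    from gpath_lipschitz[OF this lip] show "\<phi> p - \<phi> q \<le> l" by auto
  qed (use lt in simp)
qed

lemma Metric_space_gdist:
  assumes G: "metric_graph G"
  shows "Metric_space (points G) (gdist G)"
proof
  have bdd: "bdd_below {l. gpath G p q l}" for p q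
    using gpath_nonneg by (intro bdd_belowI[of _ 0]) auto
  have ne: "{l. gpath G p q l} \<noteq> {}" if "p \<in> points G" "q \<in> points G" for p q
    using gpath_exists[OF G that] by auto
  show nonneg: "0 \<le> gdist G p q" for p q
    using ne by (auto simp: gdist_def intro!: cInf_greatest intro: gpath_nonneg)
  show "gdist G p q = gdist G q p" for p q
    using gpath_sym[OF _ G] by (auto simp: gdist_def intro!: arg_cong[of _ _ Inf])
  show "gdist G p q = 0 \<longleftrightarrow> p = q" if pq: "p \<in> points G" "q \<in> points G" for p q
  proof
    assume 0: "gdist G p q = 0"
    show "p = q"
    proof (rule ccontr)
      assume "p \<noteq> q"
      then obtain \<delta> where "\<delta> > 0" "\<forall>l. gpath G p q l \<longrightarrow> \<delta> \<le> l"
        using gpath_length_lower_bound[OF G pq] by blast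
      then have "\<delta> \<le> gdist G p q"
        using pq ne by (auto simp: gdist_def intro!: cInf_greatest)
      with 0 \<open>\<delta> > 0\<close> show False by simp
    qed
  next
    assume "p = q"
    then have "gdist G p q \<le> 0"
      using pq bdd by (auto simp: gdist_def intro!: cInf_lower gpath.refl)
    with nonneg[of p q] show "gdist G p q = 0" by simp
  qed
  show "gdist G p r \<le> gdist G p q + gdist G q r"
    if pqr: "p \<in> points G" "q \<in> points G" "r \<in> points G" for p q r
  proof -
    have "gdist G p r - l \<le> gdist G q r" if l: "gpath G p q l" for l
    proof -
      have "gdist G p r \<le> l + l'" if "gpath G q r l'" for l'
        using gpath_trans[OF l that] pqr bdd by (auto simp: gdist_def intro!: cInf_lower)
      then have "gdist G p r - l \<le> l'" if "gpath G q r l'" for l'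
        using that by (simp add: algebra_simps)
      then have "gdist G p r - l \<le> Inf {l'. gpath G q r l'}"
        using ne[OF pqr(2,3)] by (intro cInf_greatest) auto
      then show ?thesis using pqr by (simp add: gdist_def)
    qed
    then have "gdist G p r - gdist G q r \<le> l" if "gpath G p q l" for l
      using that by (simp add: algebra_simps)
    then have "gdist G p r - gdist G q r \<le> Inf {l. gpath G p q l}"
      using ne[OF pqr(1,2)] by (intro cInf_greatest) auto
    then show ?thesis using pqr by (simp add: gdist_def)
  qed
qed

section \<open>Persistence diagrams of superlevel set filtrations\<close>

definition components_in :: "('v, 'e) len_graph \<Rightarrow> ('v, 'e) point set \<Rightarrow> ('v, 'e) point set set" where
  "components_in G S = connected_components_of (subtopology (gtopology G) S)"

definition superlevel :: "('v, 'e) len_graph \<Rightarrow> (('v, 'e) point \<Rightarrow> real) \<Rightarrow> real \<Rightarrow> ('v, 'e) point set" where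
  "superlevel G f \<alpha> = {x \<in> points G. f x \<ge> \<alpha>}"

text \<open>
  As the level decreases to \<open>d\<close>, the sets \<open>superlevel G f \<alpha>\<close> with \<open>\<alpha> > d\<close> exhaust the following
  set, so its components are the ones present just before time \<open>d\<close>.
\<close>

definition strict_superlevel ::
  "('v, 'e) len_graph \<Rightarrow> (('v, 'e) point \<Rightarrow> real) \<Rightarrow> real \<Rightarrow> ('v, 'e) point set" where
  "strict_superlevel G f d = (\<Union>\<alpha>\<in>{d<..}. superlevel G f \<alpha>)"

text \<open>
  By the elder rule a component carries the creation time of its oldest part, that is, the value
  of its highest local maximum.
\<close>

definition birth :: "(('v, 'e) point \<Rightarrow> real) \<Rightarrow> ('v, 'e) point set \<Rightarrow> real" where
  "birth f C = Sup (f ` C)"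

text \<open>
  The components present just before time \<open>d\<close> that lie in one component \<open>K\<close> of the superlevel set
  at \<open>d\<close> merge at time \<open>d\<close>.  One of them of maximal creation time, \<open>birth f K\<close>, survives; every
  other one contributes a point with death time \<open>d\<close>.  If several have maximal creation time, the
  resulting multiset does not depend on the choice of the survivor.
\<close>

definition dying_births ::
  "('v, 'e) len_graph \<Rightarrow> (('v, 'e) point \<Rightarrow> real) \<Rightarrow> real \<Rightarrow> ('v, 'e) point set \<Rightarrow> real multiset" where
  "dying_births G f d K =
     image_mset (birth f) (mset_set {C \<in> components_in G (strict_superlevel G f d). C \<subseteq> K})
       - {#birth f K#}"

text \<open>
  Points are pairs (birth, death).  The component that never merges into an earlier one is the
  survivor of every merge and contributes nothing.  \<open>Abs_multiset\<close> expects a multiplicity function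
  of finite support; this is the case for the distance functions to which \<open>Dg0\<close> is applied, as
  they are piecewise linear with slopes 1 and -1 on each edge.
\<close>

definition Dg0 ::
  "('v, 'e) len_graph \<Rightarrow> (('v, 'e) point \<Rightarrow> real) \<Rightarrow> (real \<times> real) multiset" where
  "Dg0 G f = Abs_multiset (\<lambda>(b, d).
     \<Sum>K\<in>components_in G (superlevel G f d). count (dying_births G f d K) b)"

section \<open>Bottleneck distance\<close>

definition linf_dist :: "real \<times> real \<Rightarrow> real \<times> real \<Rightarrow> real" where
  "linf_dist p q = max \<bar>fst p - fst q\<bar> \<bar>snd p - snd q\<bar>"

definition diagonal :: "(real \<times> real) set" where
  "diagonal = {(x, x) | x. True}"

definition closest_diagonal :: "real \<times> real \<Rightarrow> real \<times> real" where
  "closest_diagonal p = arg_min_on (linf_dist p) diagonal"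

lemma closest_diagonal_eq:
  "closest_diagonal p = ((fst p + snd p) / 2, (fst p + snd p) / 2)" (is "_ = ?m")
proof -
  have "is_arg_min (linf_dist p) (\<lambda>x. x \<in> diagonal) ?m"
    unfolding is_arg_min_linorder
  proof (intro conjI allI impI)
    show "?m \<in> diagonal" unfolding diagonal_def by blast
    show "linf_dist p ?m \<le> linf_dist p q" if "q \<in> diagonal" for q
      using that by (auto simp: linf_dist_def diagonal_def field_simps abs_if max_def)
  qed
  moreover have "q = ?m" if min: "is_arg_min (linf_dist p) (\<lambda>x. x \<in> diagonal) q" for q
  proof -
    obtain x where q: "q = (x, x)"
      using min unfolding is_arg_min_linorder diagonal_def by blast
    have "?m \<in> diagonal" unfolding diagonal_def by blast
    then have "linf_dist p q \<le> linf_dist p ?m"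
      using min unfolding is_arg_min_linorder by blast
    then have "x = (fst p + snd p) / 2"
      by (auto simp: q linf_dist_def field_simps abs_if max_def split: if_splits)
    then show ?thesis by (simp add: q)
  qed
  ultimately show ?thesis
    unfolding closest_diagonal_def arg_min_on_def arg_min_def by (rule some_equality)
qed

text \<open>
  \<open>M\<close> consists of the matched pairs of off-diagonal points; all points (counted with multiplicity)
  not occurring in \<open>M\<close> are matched to the diagonal.
\<close>

definition partial_matching ::
  "(real \<times> real) multiset \<Rightarrow> (real \<times> real) multiset
     \<Rightarrow> ((real \<times> real) \<times> (real \<times> real)) multiset \<Rightarrow> bool" where
  "partial_matching D D' C \<longleftrightarrow>
     (\<exists>M. image_mset fst M \<subseteq># D \<and> image_mset snd M \<subseteq># D' \<and>
        C = M + {#(p, closest_diagonal p). p \<in># D - image_mset fst M#}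
              + {#(closest_diagonal q, q). q \<in># D' - image_mset snd M#})"

lemma finite_partial_matchings: "finite {C. partial_matching D D' C}"
proof -
  let ?N = "\<Union>n\<in>{..size D}. multisets_of_size (set_mset D \<times> set_mset D') n"
  let ?C = "\<lambda>M. M + {#(p, closest_diagonal p). p \<in># D - image_mset fst M#}
              + {#(closest_diagonal q, q). q \<in># D' - image_mset snd M#}"
  have "M \<in> ?N" if M: "image_mset fst M \<subseteq># D" "image_mset snd M \<subseteq># D'" for M
  proof -
    have "set_mset M \<subseteq> set_mset D \<times> set_mset D'"
      using set_mset_mono[OF M(1)] set_mset_mono[OF M(2)] by fastforce
    moreover have "size M \<le> size D" using size_mset_mono[OF M(1)] by simp
    ultimately show ?thesis by (auto simp: multisets_of_size_def)
  qed
  then have "{C. partial_matching D D' C} \<subseteq> ?C ` ?N"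
    unfolding partial_matching_def by blast
  moreover have "finite ?N" by (auto intro: finite_multisets_of_size)
  ultimately show ?thesis by (meson finite_imageI finite_subset)
qed

text \<open>The cost of the empty matching, between two empty diagrams, is 0.\<close>

definition matching_cost :: "((real \<times> real) \<times> (real \<times> real)) multiset \<Rightarrow> real" where
  "matching_cost C = Max (insert 0 ((\<lambda>(p, q). linf_dist p q) ` set_mset C))"

definition bottleneck_dist :: "(real \<times> real) multiset \<Rightarrow> (real \<times> real) multiset \<Rightarrow> real" where
  "bottleneck_dist D D' = Min (matching_cost ` {C. partial_matching D D' C})"

section \<open>Persistence-distortion distance\<close>

definition hausdorff_dist :: "('a \<Rightarrow> 'b \<Rightarrow> real) \<Rightarrow> 'a set \<Rightarrow> 'b set \<Rightarrow> real" where
  "hausdorff_dist \<delta> A B = max (SUP a\<in>A. INF b\<in>B. \<delta> a b) (SUP b\<in>B. INF a\<in>A. \<delta> a b)"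

definition dist_diagrams :: "('v, 'e) len_graph \<Rightarrow> (real \<times> real) multiset set" where
  "dist_diagrams G = {Dg0 G (gdist G s) | s. s \<in> points G}"

definition d_PD :: "('v, 'e) len_graph \<Rightarrow> ('w, 'f) len_graph \<Rightarrow> real" where
  "d_PD G1 G2 = hausdorff_dist bottleneck_dist (dist_diagrams G1) (dist_diagrams G2)"

section \<open>Gromov-Hausdorff distance\<close>

definition correspondence :: "'a set \<Rightarrow> 'b set \<Rightarrow> ('a \<times> 'b) set \<Rightarrow> bool" where
  "correspondence X Y M \<longleftrightarrow> M \<subseteq> X \<times> Y \<and> fst ` M = X \<and> snd ` M = Y"

definition distortion ::
  "('a \<Rightarrow> 'a \<Rightarrow> real) \<Rightarrow> ('b \<Rightarrow> 'b \<Rightarrow> real) \<Rightarrow> ('a \<times> 'b) set \<Rightarrow> real" where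
  "distortion dX dY M = Sup {\<bar>dX x1 x2 - dY y1 y2\<bar> | x1 y1 x2 y2. (x1, y1) \<in> M \<and> (x2, y2) \<in> M}"

definition GH_dist ::
  "'a set \<Rightarrow> ('a \<Rightarrow> 'a \<Rightarrow> real) \<Rightarrow> 'b set \<Rightarrow> ('b \<Rightarrow> 'b \<Rightarrow> real) \<Rightarrow> real" where
  "GH_dist X dX Y dY = (1/2) * (INF M\<in>{M. correspondence X Y M}. distortion dX dY M)"

definition d_GH :: "('v, 'e) len_graph \<Rightarrow> ('w, 'f) len_graph \<Rightarrow> real" where
  "d_GH G1 G2 = GH_dist (points G1) (gdist G1) (points G2) (gdist G2)"

end

theory Submission
  imports Defs
begin

text \<open>
  Let \<open>M\<close> be a correspondence of distortion at most \<open>\<epsilon>\<close> and \<open>(s, t) \<in> M\<close>.  Finitely many pairs of \<open>M\<close>,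
  among them one over a maximum of \<open>d(s, _)\<close> or \<open>d(t, _)\<close> on each of finitely many arcs, determine
  both diagrams: a diagram depends only on the values of the distance function at the sample (births)
  and on the levels at which sample points become connected (merge levels).  On the sample the births
  for \<open>s\<close> and \<open>t\<close> differ by at most \<open>\<epsilon>\<close>.  The merge levels differ by at most \<open>3\<epsilon>\<close>: points of a
  superlevel set at distance less than \<open>\<epsilon>\<close> correspond to points joined by a path shorter than
  \<open>2\<epsilon>\<close>, along which the other distance function drops by less than \<open>2\<epsilon>\<close>.

  For fixed births, the elder rule matches each sample point with itself and the deaths move no more
  than the merge levels.  For fixed merge levels, interpolate the births linearly: the order of births
  changes only at ties, and there the bars do not depend on how the ties are broken.  So the bottleneck
  distance is at most \<open>3\<epsilon>\<close>, and the infimum of the distortions is \<open>2 d_GH\<close>.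
\<close>

subsection \<open>Bottleneck distance\<close>

lemma linf_dist_triangle: "linf_dist p r \<le> linf_dist p q + linf_dist q r"
  unfolding linf_dist_def by linarith

lemma linf_dist_commute: "linf_dist p q = linf_dist q p"
  by (simp add: linf_dist_def abs_minus_commute)

lemma linf_dist_self [simp]: "linf_dist p p = 0"
  by (simp add: linf_dist_def)

lemma closest_diagonal_in_diagonal: "closest_diagonal p \<in> diagonal"
  unfolding closest_diagonal_eq diagonal_def by blast

lemma linf_dist_closest_diagonal_le:
  assumes "q \<in> diagonal"
  shows "linf_dist p (closest_diagonal p) \<le> linf_dist p q"
  using assms by (auto simp: closest_diagonal_eq linf_dist_def diagonal_def field_simps abs_if max_def)

text \<open>
  Padding both diagrams with arbitrary diagonal points turns partial matchings into bijections,
  which compose.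
\<close>

definition diag_matched ::
  "real \<Rightarrow> (real \<times> real) multiset \<Rightarrow> (real \<times> real) multiset \<Rightarrow> bool" where
  "diag_matched \<epsilon> D D' \<longleftrightarrow>
     (\<exists>\<Delta> \<Delta>'. set_mset \<Delta> \<subseteq> diagonal \<and> set_mset \<Delta>' \<subseteq> diagonal \<and>
        rel_mset (\<lambda>p q. linf_dist p q \<le> \<epsilon>) (D + \<Delta>) (D' + \<Delta>'))"

lemma rel_mset_iff:
  "rel_mset R A B \<longleftrightarrow>
     (\<exists>N. image_mset fst N = A \<and> image_mset snd N = B \<and> (\<forall>(p, q)\<in>#N. R p q))"
  unfolding multiset.in_rel by auto

lemma rel_mset_add:
  assumes "rel_mset R A B" "rel_mset R A' B'"
  shows "rel_mset R (A + A') (B + B')"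
proof -
  obtain N N' where
    "image_mset fst N = A" "image_mset snd N = B" "\<forall>(p, q)\<in>#N. R p q"
    "image_mset fst N' = A'" "image_mset snd N' = B'" "\<forall>(p, q)\<in>#N'. R p q"
    using assms unfolding rel_mset_iff by auto
  then show ?thesis unfolding rel_mset_iff by (intro exI[of _ "N + N'"]) auto
qed

lemma rel_mset_OO:
  assumes "rel_mset R A B" "rel_mset S B C"
  shows "rel_mset (R OO S) A C"
  using assms by (auto simp: multiset.rel_compp)

lemma diag_matched_sym: "diag_matched \<epsilon> D D' \<Longrightarrow> diag_matched \<epsilon> D' D"
  unfolding diag_matched_def
  by (metis (no_types, lifting) linf_dist_commute multiset.rel_flip multiset.rel_mono_strong conversep_iff)

text \<open>The two paddings of the middle diagram \<open>D'\<close> need not agree. Each matching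
  is therefore extended by the padding that the other one uses for \<open>D'\<close>, the extra
  diagonal points being matched to themselves at cost 0.\<close>

lemma diag_matched_trans:
  assumes "diag_matched \<epsilon> D D'" "diag_matched \<epsilon>' D' D''"
    and nonneg: "0 \<le> \<epsilon>" "0 \<le> \<epsilon>'"
  shows "diag_matched (\<epsilon> + \<epsilon>') D D''"
proof -
  obtain A B where AB: "set_mset A \<subseteq> diagonal" "set_mset B \<subseteq> diagonal"
    "rel_mset (\<lambda>p q. linf_dist p q \<le> \<epsilon>) (D + A) (D' + B)"
    using assms(1) unfolding diag_matched_def by blast
  obtain A' B' where AB': "set_mset A' \<subseteq> diagonal" "set_mset B' \<subseteq> diagonal"
    "rel_mset (\<lambda>p q. linf_dist p q \<le> \<epsilon>') (D' + A') (D'' + B')"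
    using assms(2) unfolding diag_matched_def by blast
  have "rel_mset (\<lambda>p q. linf_dist p q \<le> \<epsilon>) A' A'"
    by (rule multiset.rel_refl_strong) (simp add: nonneg)
  from rel_mset_add[OF AB(3) this]
  have 1: "rel_mset (\<lambda>p q. linf_dist p q \<le> \<epsilon>) (D + (A + A')) (D' + A' + B)"
    by (simp add: ac_simps)
  have "rel_mset (\<lambda>p q. linf_dist p q \<le> \<epsilon>') B B"
    by (rule multiset.rel_refl_strong) (simp add: nonneg)
  from rel_mset_add[OF AB'(3) this]
  have 2: "rel_mset (\<lambda>p q. linf_dist p q \<le> \<epsilon>') (D' + A' + B) (D'' + (B' + B))"
    by (simp add: ac_simps)
  have "rel_mset (\<lambda>p q. linf_dist p q \<le> \<epsilon> + \<epsilon>') (D + (A + A')) (D'' + (B' + B))"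
    using rel_mset_OO[OF 1 2]
    by (rule multiset.rel_mono_strong) (auto intro: order_trans[OF linf_dist_triangle] add_mono)
  with AB AB' show ?thesis
    unfolding diag_matched_def by (intro exI[of _ "A + A'"] exI[of _ "B' + B"]) auto
qed

section \<open>Partial matchings against padded bijections\<close>

lemma partial_matching_empty:
  "partial_matching D D'
     (image_mset (\<lambda>p. (p, closest_diagonal p)) D + image_mset (\<lambda>q. (closest_diagonal q, q)) D')"
  unfolding partial_matching_def by (rule exI[of _ "{#}"]) simp

lemma matching_cost_le_iff:
  "matching_cost C \<le> \<epsilon> \<longleftrightarrow> 0 \<le> \<epsilon> \<and> (\<forall>(p, q)\<in>#C. linf_dist p q \<le> \<epsilon>)"
  unfolding matching_cost_def by (subst Max_le_iff) auto

lemma bottleneck_dist_witness: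
  "\<exists>C. partial_matching D D' C \<and> matching_cost C = bottleneck_dist D D'"
proof -
  have "bottleneck_dist D D' \<in> matching_cost ` {C. partial_matching D D' C}"
    unfolding bottleneck_dist_def
    using finite_partial_matchings partial_matching_empty[of D D'] by (intro Min_in) auto
  then show ?thesis by auto
qed

lemma bottleneck_dist_nonneg: "0 \<le> bottleneck_dist D D'"
  using bottleneck_dist_witness[of D D'] matching_cost_le_iff by (metis order_refl)

text \<open>The projections of the unmatched points of each diagram serve as padding of the other,
  which turns an optimal partial matching into a bijection.\<close>

lemma diag_matched_bottleneck_dist: "diag_matched (bottleneck_dist D D') D D'"
proof -
  obtain C where C: "partial_matching D D' C" "matching_cost C = bottleneck_dist D D'"
    using bottleneck_dist_witness by blast
  obtain M where M: "image_mset fst M \<subseteq># D" "image_mset snd M \<subseteq># D'"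
    "C = M + {#(p, closest_diagonal p). p \<in># D - image_mset fst M#}
              + {#(closest_diagonal q, q). q \<in># D' - image_mset snd M#}"
    using C(1) unfolding partial_matching_def by blast
  have le: "\<forall>(p, q)\<in>#C. linf_dist p q \<le> bottleneck_dist D D'"
    using C(2) matching_cost_le_iff by (metis order_refl)
  have fst: "image_mset fst C = D + image_mset closest_diagonal (D' - image_mset snd M)"
    using M(1) by (simp add: M(3) multiset.map_comp comp_def)
  have snd: "image_mset snd C = D' + image_mset closest_diagonal (D - image_mset fst M)"
    using M(2) by (simp add: M(3) multiset.map_comp comp_def)
  have "rel_mset (\<lambda>p q. linf_dist p q \<le> bottleneck_dist D D') (image_mset fst C) (image_mset snd C)"
    unfolding rel_mset_iff using le by blast
  then show ?thesis
    unfolding diag_matched_def fst snd using closest_diagonal_in_diagonal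
    by (intro exI[of _ "image_mset closest_diagonal (D' - image_mset snd M)"]
        exI[of _ "image_mset closest_diagonal (D - image_mset fst M)"]) auto
qed

text \<open>The pairs of a padded bijection are of four kinds. Pairs of two genuine points are kept;
  a genuine point paired with padding is sent to its closest diagonal point instead, at no greater
  cost; pairs of two padding points are dropped.\<close>

lemma bottleneck_dist_le:
  assumes "diag_matched \<epsilon> D D'" "0 \<le> \<epsilon>"
  shows "bottleneck_dist D D' \<le> \<epsilon>"
proof -
  obtain \<Delta> \<Delta>' N where diag: "set_mset \<Delta> \<subseteq> diagonal" "set_mset \<Delta>' \<subseteq> diagonal"
    and N: "image_mset fst N = D + \<Delta>" "image_mset snd N = D' + \<Delta>'"
    and le: "\<forall>(p, q)\<in>#N. linf_dist p q \<le> \<epsilon>"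
    using assms(1) unfolding diag_matched_def rel_mset_iff by blast
  obtain N1 N2 where N12: "N = N1 + N2" "D = image_mset fst N1" "\<Delta> = image_mset fst N2"
    using image_mset_eq_plusD[OF N(1)] by blast
  have "image_mset snd N1 + image_mset snd N2 = D' + \<Delta>'"
    using N(2) N12(1) by simp
  \<comment> \<open>Genuine and padding points may coincide as elements, so the partners of
    \<open>D\<close> are divided by convention: as many as possible, \<open>Q\<close>, count as
    points of \<open>D'\<close>, the excess \<open>S\<close> as padding.\<close>
  define Q where "Q = image_mset snd N1 \<inter># D'"
  define S where "S = image_mset snd N1 - D'"
  have Q: "image_mset snd N1 = Q + S" "Q \<subseteq># D'"
    unfolding Q_def S_def by (auto intro!: multiset_eqI)
  have D': "D' = Q + (D' - Q)" using Q(2) by simp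
  have S: "S + image_mset snd N2 = (D' - Q) + \<Delta>'"
    using \<open>image_mset snd N1 + image_mset snd N2 = D' + \<Delta>'\<close> Q(1) D'
    by (metis add.assoc add_left_imp_eq)
  \<comment> \<open>By maximality of \<open>Q\<close> nothing is left over on both sides. Hence the
    excess comes from the padding \<open>\<Delta>'\<close>, and the rest of \<open>D'\<close> is
    paired with the padding of \<open>D\<close>.\<close>
  have "S \<inter># (D' - Q) = {#}"
    unfolding S_def Q_def by (auto intro!: multiset_eqI)
  then have S': "S \<subseteq># \<Delta>'" "D' - Q \<subseteq># image_mset snd N2"
  proof -
    have *: "min (count S x) (count (D' - Q) x) = 0"
      "count S x + count (image_mset snd N2) x = count (D' - Q) x + count \<Delta>' x" for x
      using arg_cong[OF \<open>S \<inter># (D' - Q) = {#}\<close>, of "\<lambda>A. count A x"]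
        arg_cong[OF S, of "\<lambda>A. count A x"] by (simp_all only: count_inter_mset inf_nat_def count_empty count_union)
    show "S \<subseteq># \<Delta>'" "D' - Q \<subseteq># image_mset snd N2"
      unfolding subseteq_mset_def using * by (smt (verit) min_def add_leD1 add_leD2 le_add1 le_add2 add_0)+
  qed
  obtain M M' where M: "N1 = M + M'" "Q = image_mset snd M" "S = image_mset snd M'"
    using image_mset_eq_plusD[OF Q(1)] by blast
  obtain K where "image_mset snd N2 = (D' - Q) + K"
    using S'(2) by (metis subset_mset.add_diff_inverse)
  then obtain L L' where L: "N2 = L + L'" "D' - Q = image_mset snd L"
    using image_mset_eq_plusD[of snd N2 "D' - Q" K] by blast
  let ?C = "M + {#(p, closest_diagonal p). p \<in># D - image_mset fst M#}
              + {#(closest_diagonal q, q). q \<in># D' - image_mset snd M#}"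
  have pm: "partial_matching D D' ?C"
    unfolding partial_matching_def
    by (rule exI[of _ M]) (use N12(2) M(1,2) Q(2) in auto)
  have DM: "D - image_mset fst M = image_mset fst M'"
    using N12(2) M(1) by simp
  have "linf_dist p (closest_diagonal p) \<le> \<epsilon>" if "p \<in># image_mset fst M'" for p
  proof -
    obtain q where q: "(p, q) \<in># M'" using \<open>p \<in># image_mset fst M'\<close> by auto
    then have "q \<in># S" using M(3) by force
    then have "q \<in> diagonal" using S'(1) diag(2) by (meson mset_subset_eqD subsetD)
    moreover have "linf_dist p q \<le> \<epsilon>" using q le N12(1) M(1) by auto
    ultimately show ?thesis using linf_dist_closest_diagonal_le[of q p] by linarith
  qed
  moreover have "linf_dist (closest_diagonal q) q \<le> \<epsilon>" if "q \<in># image_mset snd L" for q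
  proof -
    obtain p where p: "(p, q) \<in># L" using \<open>q \<in># image_mset snd L\<close> by auto
    then have "p \<in># \<Delta>" using N12(3) L(1) by force
    then have "p \<in> diagonal" using diag(1) by blast
    moreover have "linf_dist p q \<le> \<epsilon>" using p le N12(1) L(1) by auto
    ultimately show ?thesis
      using linf_dist_closest_diagonal_le[of p q] linf_dist_commute by (metis order_trans)
  qed
  moreover have "linf_dist p q \<le> \<epsilon>" if "(p, q) \<in># M" for p q
    using le that unfolding N12(1) M(1) by auto
  moreover have "D' - image_mset snd M = image_mset snd L" using L(2) M(2) by simp
  ultimately have "\<forall>(p, q)\<in>#?C. linf_dist p q \<le> \<epsilon>"
    unfolding DM by (auto simp del: set_image_mset simp: set_image_mset[of "\<lambda>p. (p, closest_diagonal p)"]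
        set_image_mset[of "\<lambda>q. (closest_diagonal q, q)"])
  then have "matching_cost ?C \<le> \<epsilon>"
    unfolding matching_cost_le_iff using assms(2) by blast
  moreover have "bottleneck_dist D D' \<le> matching_cost ?C"
    unfolding bottleneck_dist_def
    by (rule Min_le[OF finite_imageI[OF finite_partial_matchings] imageI]) (use pm in simp)
  ultimately show ?thesis by (rule order_trans[rotated])
qed

lemma bottleneck_dist_commute: "bottleneck_dist D D' = bottleneck_dist D' D"
  by (meson antisym bottleneck_dist_le bottleneck_dist_nonneg diag_matched_bottleneck_dist
      diag_matched_sym)

lemma bottleneck_dist_triangle:
  "bottleneck_dist D D'' \<le> bottleneck_dist D D' + bottleneck_dist D' D''"
  by (intro bottleneck_dist_le diag_matched_trans[of _ _ D'] diag_matched_bottleneck_dist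
      add_nonneg_nonneg bottleneck_dist_nonneg)

subsection \<open>Hausdorff distance\<close>

lemma hausdorff_dist_commute:
  assumes "\<And>a b. \<delta> a b = \<delta>' b a"
  shows "hausdorff_dist \<delta> A B = hausdorff_dist \<delta>' B A"
  unfolding hausdorff_dist_def assms by (simp add: max.commute)

lemma hausdorff_dist_le:
  fixes \<delta> :: "'a \<Rightarrow> 'b \<Rightarrow> real"
  assumes "A \<noteq> {}" "B \<noteq> {}" and nonneg: "\<And>a b. 0 \<le> \<delta> a b"
    and "\<And>a. a \<in> A \<Longrightarrow> \<exists>b\<in>B. \<delta> a b \<le> c" "\<And>b. b \<in> B \<Longrightarrow> \<exists>a\<in>A. \<delta> a b \<le> c"
  shows "hausdorff_dist \<delta> A B \<le> c"
proof -
  have "bdd_below ((\<lambda>b. \<delta> a b) ` B)" "bdd_below ((\<lambda>a. \<delta> a b) ` A)" for a b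
    using nonneg by (auto intro: bdd_belowI[of _ 0])
  then show ?thesis
    unfolding hausdorff_dist_def using assms
    by (intro max.boundedI cSUP_least) (meson cINF_lower2)+
qed

text \<open>Without the bound \<open>K\<close> the suprema of unbounded sets of reals would be junk values.\<close>

lemma hausdorff_dist_triangle:
  fixes \<delta> :: "'a \<Rightarrow> 'a \<Rightarrow> real"
  assumes ne: "A \<noteq> {}" "B \<noteq> {}" "C \<noteq> {}" and nonneg: "\<And>a b. 0 \<le> \<delta> a b"
    and tri: "\<And>a b c. \<delta> a c \<le> \<delta> a b + \<delta> b c"
    and K: "\<And>a b. a \<in> A \<Longrightarrow> b \<in> B \<Longrightarrow> \<delta> a b \<le> K" "\<And>b c. b \<in> B \<Longrightarrow> c \<in> C \<Longrightarrow> \<delta> b c \<le> K"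
  shows "hausdorff_dist \<delta> A C \<le> hausdorff_dist \<delta> A B + hausdorff_dist \<delta> B C"
proof -
  have near: "\<exists>b\<in>B. \<delta> a b < hausdorff_dist \<delta> A B + e" "\<exists>a\<in>A. \<delta> a b < hausdorff_dist \<delta> A B + e"
    if "A \<noteq> {}" "B \<noteq> {}" "e > 0" "\<And>a b. a \<in> A \<Longrightarrow> b \<in> B \<Longrightarrow> \<delta> a b \<le> K"
      "a \<in> A" "b \<in> B" for A B a b e
  proof -
    have bb: "bdd_below ((\<lambda>b. \<delta> a b) ` B)" "bdd_below ((\<lambda>a. \<delta> a b) ` A)" for a b
      using nonneg by (auto intro: bdd_belowI[of _ 0])
    have "bdd_above ((\<lambda>a. INF b\<in>B. \<delta> a b) ` A)"
      using that bb by (intro bdd_aboveI2[of _ _ K]) (meson cINF_lower2 ex_in_conv)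
    then have "(INF b\<in>B. \<delta> a b) \<le> hausdorff_dist \<delta> A B"
      unfolding hausdorff_dist_def using that by (meson cSUP_upper max.coboundedI1)
    then have "(INF b\<in>B. \<delta> a b) < hausdorff_dist \<delta> A B + e" using \<open>e > 0\<close> by linarith
    then show "\<exists>b\<in>B. \<delta> a b < hausdorff_dist \<delta> A B + e"
      using bb that by (simp add: cINF_less_iff)
    have "bdd_above ((\<lambda>b. INF a\<in>A. \<delta> a b) ` B)"
      using that bb by (intro bdd_aboveI2[of _ _ K]) (meson cINF_lower2 ex_in_conv)
    then have "(INF a\<in>A. \<delta> a b) \<le> hausdorff_dist \<delta> A B"
      unfolding hausdorff_dist_def using that by (meson cSUP_upper max.coboundedI2)
    then have "(INF a\<in>A. \<delta> a b) < hausdorff_dist \<delta> A B + e" using \<open>e > 0\<close> by linarith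
    then show "\<exists>a\<in>A. \<delta> a b < hausdorff_dist \<delta> A B + e"
      using bb that by (simp add: cINF_less_iff)
  qed
  \<comment> \<open>The infima are only approached, hence the slack \<open>e\<close>, split evenly
    between the two legs of the detour through \<open>B\<close>.\<close>
  have "hausdorff_dist \<delta> A C \<le> hausdorff_dist \<delta> A B + hausdorff_dist \<delta> B C + e" if "e > 0" for e
  proof (rule hausdorff_dist_le[OF ne(1,3) nonneg])
    fix a assume a: "a \<in> A"
    from near(1)[OF ne(1,2), of "e/2" a] K(1) a that ne obtain b where b: "b \<in> B"
      "\<delta> a b < hausdorff_dist \<delta> A B + e/2" by force
    from near(1)[OF ne(2,3), of "e/2" b] K(2) b that ne obtain c where c: "c \<in> C"
      "\<delta> b c < hausdorff_dist \<delta> B C + e/2" by force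
    show "\<exists>c\<in>C. \<delta> a c \<le> hausdorff_dist \<delta> A B + hausdorff_dist \<delta> B C + e"
      using b c tri[of a c b] by (intro bexI[of _ c]) auto
  next
    fix c assume c: "c \<in> C"
    from near(2)[OF ne(2,3), of "e/2" _ c] K(2) c that ne obtain b where b: "b \<in> B"
      "\<delta> b c < hausdorff_dist \<delta> B C + e/2" by force
    from near(2)[OF ne(1,2), of "e/2" _ b] K(1) b that ne obtain a where a: "a \<in> A"
      "\<delta> a b < hausdorff_dist \<delta> A B + e/2" by force
    show "\<exists>a\<in>A. \<delta> a c \<le> hausdorff_dist \<delta> A B + hausdorff_dist \<delta> B C + e"
      using a b tri[of a c b] by (intro bexI[of _ a]) auto
  qed
  then show ?thesis by (meson field_le_epsilon)
qed

subsection \<open>Finite merge trees\<close>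

text \<open>
  \<open>f x\<close> is the level at which \<open>x\<close> appears, \<open>m x y\<close> the highest level at which \<open>x\<close> and \<open>y\<close> are
  connected.
\<close>

locale merge_tree =
  fixes Z :: "'a set" and f :: "'a \<Rightarrow> real" and m :: "'a \<Rightarrow> 'a \<Rightarrow> real"
  assumes finite: "finite Z"
    and sym: "\<lbrakk>x \<in> Z; y \<in> Z\<rbrakk> \<Longrightarrow> m x y = m y x"
    and ultra: "\<lbrakk>x \<in> Z; y \<in> Z; z \<in> Z\<rbrakk> \<Longrightarrow> min (m x y) (m y z) \<le> m x z"
    and le: "\<lbrakk>x \<in> Z; y \<in> Z\<rbrakk> \<Longrightarrow> m x y \<le> f x"

text \<open>
  A ranking breaks ties in the elder rule; smaller rank means older.  The eldest element has no death
  (the maximum below is then over the empty set) and is left out of the bars; bars of length zero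
  are kept.
\<close>

definition ranking :: "('a \<Rightarrow> nat) \<Rightarrow> 'a set \<Rightarrow> ('a \<Rightarrow> real) \<Rightarrow> bool" where
  "ranking k Z f \<longleftrightarrow> inj_on k Z \<and> (\<forall>x\<in>Z. \<forall>y\<in>Z. f x < f y \<longrightarrow> k y < k x)"

definition death :: "('a \<Rightarrow> nat) \<Rightarrow> 'a set \<Rightarrow> ('a \<Rightarrow> 'a \<Rightarrow> real) \<Rightarrow> 'a \<Rightarrow> real" where
  "death k Z m x = Max (m x ` {y \<in> Z. k y < k x})"

definition bars ::
  "('a \<Rightarrow> nat) \<Rightarrow> 'a set \<Rightarrow> ('a \<Rightarrow> real) \<Rightarrow> ('a \<Rightarrow> 'a \<Rightarrow> real) \<Rightarrow> (real \<times> real) multiset" where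
  "bars k Z f m = image_mset (\<lambda>x. (f x, death k Z m x)) (mset_set {x \<in> Z. \<exists>y\<in>Z. k y < k x})"

text \<open>\<open>U\<close> stands for an up-closed set of levels: \<open>{d..}\<close> describes
  the state at time \<open>d\<close> and \<open>{d<..}\<close> the state just before. The elders are
  the elements of birth \<open>b\<close> that head their component in that state.\<close>

definition elders ::
  "('a \<Rightarrow> nat) \<Rightarrow> 'a set \<Rightarrow> ('a \<Rightarrow> real) \<Rightarrow> ('a \<Rightarrow> 'a \<Rightarrow> real) \<Rightarrow> real set \<Rightarrow> real \<Rightarrow> 'a set" where
  "elders k Z f m U b = {x \<in> Z. f x = b \<and> \<not> (\<exists>y\<in>Z. k y < k x \<and> m x y \<in> U)}"

text \<open>Sort by \<open>f\<close>, then by \<open>g\<close>, then by an arbitrary injection, and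
  let the rank count the older elements. Since \<open>g\<close> never reverses a strict comparison
  of \<open>f\<close>, this order respects \<open>g\<close> as well.\<close>

lemma exists_common_ranking:
  assumes Z: "finite Z" and fg: "\<And>x y. \<lbrakk>x \<in> Z; y \<in> Z; f x < f y\<rbrakk> \<Longrightarrow> g x \<le> (g y :: real)"
  shows "\<exists>k. ranking k Z f \<and> ranking k Z g"
proof -
  obtain i :: "'a \<Rightarrow> nat" where i: "inj_on i Z"
    using finite_imp_inj_to_nat_seg[OF Z] by blast
  define L where "L y x \<longleftrightarrow> f x < f y \<or> f x = f y \<and> (g x < g y \<or> g x = g y \<and> i y < i x)" for x y
  define k where "k x = card {y \<in> Z. L y x}" for x
  have mono: "k y < k x" if "y \<in> Z" "L y x" for x y
  proof -
    have "{z \<in> Z. L z y} \<subset> {z \<in> Z. L z x}" using that by (auto simp: L_def)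
    then show ?thesis unfolding k_def using Z by (intro psubset_card_mono) auto
  qed
  have total: "L y x \<or> L x y" if "x \<in> Z" "y \<in> Z" "x \<noteq> y" for x y
    using inj_onD[OF i _ that(1,2)] that(3) unfolding L_def by (meson linorder_neqE)
  have "inj_on k Z"
    by (rule inj_onI) (metis total mono less_irrefl)
  moreover have "L y x" if "x \<in> Z" "y \<in> Z" "f x < f y \<or> g x < g y" for x y
    using that fg[of y x] unfolding L_def by force
  ultimately show ?thesis unfolding ranking_def using mono by blast
qed

lemma exists_ranking: "finite Z \<Longrightarrow> \<exists>k. ranking k Z f"
  using exists_common_ranking[of Z f f] by force

text \<open>Each component is headed by its element of smallest rank, whose birth is that of the
  component. The map \<open>\<kappa>\<close> is kept abstract so that it can be the class map of a
  merge tree or the passage to topological components. The case \<open>x = y\<close> is excluded in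
  \<open>eq\<close> because \<open>m x x\<close> is only bounded above by
  \<open>f x\<close>.\<close>

lemma card_elders:
  assumes k: "ranking k Z f" and Z: "finite Z" and U: "\<And>u v. u \<in> U \<Longrightarrow> u \<le> v \<Longrightarrow> v \<in> U"
    and le: "\<And>x y. \<lbrakk>x \<in> Z; y \<in> Z\<rbrakk> \<Longrightarrow> m x y \<le> f x \<and> m x y \<le> f y"
    and b: "b \<in> U"
    and \<kappa>: "\<kappa> ` {x \<in> Z. f x \<in> U} = \<C>"
    and eq: "\<And>x y. \<lbrakk>x \<in> Z; y \<in> Z; f x \<in> U; f y \<in> U; x \<noteq> y\<rbrakk> \<Longrightarrow> \<kappa> x = \<kappa> y \<longleftrightarrow> m x y \<in> U"
    and \<beta>: "\<And>x. \<lbrakk>x \<in> Z; f x \<in> U\<rbrakk> \<Longrightarrow> f x \<le> \<beta> (\<kappa> x)"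
      "\<And>C. C \<in> \<C> \<Longrightarrow> \<exists>x\<in>Z. f x \<in> U \<and> \<kappa> x = C \<and> \<beta> C = f x"
  shows "card (elders k Z f m U b) = card {C \<in> \<C>. \<beta> C = b}"
proof -
  have older: "k y < k x \<or> x = y" if "x \<in> Z" "y \<in> Z" "\<not> k x < k y" for x y
    using k that unfolding ranking_def inj_on_def by (meson linorder_neqE_nat)
  have eq': "\<kappa> x = \<kappa> y" if "x \<in> Z" "y \<in> Z" "m x y \<in> U" for x y
    using eq[of x y] that le[of x y] U by blast
  have "bij_betw \<kappa> (elders k Z f m U b) {C \<in> \<C>. \<beta> C = b}"
    unfolding bij_betw_def
  proof (intro conjI inj_onI subset_antisym subsetI)
    fix x y assume "x \<in> elders k Z f m U b" "y \<in> elders k Z f m U b" "\<kappa> x = \<kappa> y"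
    then show "x = y"
      using eq[of x y] eq[of y x] older[of x y] b unfolding elders_def by auto
  next
    fix C assume "C \<in> \<kappa> ` elders k Z f m U b"
    then obtain x where x: "x \<in> Z" "f x = b" "C = \<kappa> x"
      and min: "\<And>y. \<lbrakk>y \<in> Z; m x y \<in> U\<rbrakk> \<Longrightarrow> \<not> k y < k x"
      unfolding elders_def by auto
    then have C: "C \<in> \<C>" using \<kappa> b by auto
    obtain y where y: "y \<in> Z" "f y \<in> U" "\<kappa> y = C" "\<beta> C = f y" using \<beta>(2)[OF C] by blast
    have "f y \<le> f x"
    proof (rule ccontr)
      assume "\<not> f y \<le> f x"
      then have "k y < k x" using k x(1) y(1) unfolding ranking_def by auto
      moreover have "m x y \<in> U" using eq[of x y] x y b \<open>\<not> f y \<le> f x\<close> by auto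
      ultimately show False using min y(1) by blast
    qed
    then have "\<beta> C = b" using \<beta>(1)[of x] x y(4) b by simp
    with C show "C \<in> {C \<in> \<C>. \<beta> C = b}" by simp
  next
    fix C assume "C \<in> {C \<in> \<C>. \<beta> C = b}"
    then have C: "C \<in> \<C>" "\<beta> C = b" by auto
    define F where "F = {x \<in> Z. f x \<in> U \<and> \<kappa> x = C}"
    define x where "x = arg_min_on k F"
    have "finite F" "F \<noteq> {}" using Z \<beta>(2)[OF C(1)] by (auto simp: F_def)
    then have x: "x \<in> F" and min: "\<And>y. y \<in> F \<Longrightarrow> k x \<le> k y"
      unfolding x_def by (auto intro: arg_min_if_finite arg_min_least)
    obtain y where y: "y \<in> F" "\<beta> C = f y" using \<beta>(2)[OF C(1)] by (auto simp: F_def)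
    have "f y \<le> f x"
      using k min[OF y(1)] x y(1) unfolding ranking_def F_def
      by (metis (mono_tags, lifting) mem_Collect_eq leI not_less)
    then have fx: "f x = b" using \<beta>(1)[of x] x y(2) C by (auto simp: F_def)
    have "\<not> k y < k x" if "y \<in> Z" "m x y \<in> U" for y
    proof -
      have "\<kappa> y = C" using eq'[of x y] x that by (simp add: F_def)
      moreover have "f y \<in> U" using le[of x y] U x that by (auto simp: F_def)
      ultimately show ?thesis using min[of y] that(1) by (auto simp: F_def)
    qed
    then have "x \<in> elders k Z f m U b" using x fx by (auto simp: elders_def F_def)
    moreover have "\<kappa> x = C" using x by (simp add: F_def)
    ultimately show "C \<in> \<kappa> ` elders k Z f m U b" by blast
  qed
  then show ?thesis by (rule bij_betw_same_card)
qed

section \<open>Bars of one merge tree and independence of the ranking\<close>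

context merge_tree
begin

lemma le_both: "\<lbrakk>x \<in> Z; y \<in> Z\<rbrakk> \<Longrightarrow> m x y \<le> f x \<and> m x y \<le> f y"
  using le[of x y] le[of y x] sym[of x y] by simp

lemma death_le_iff:
  assumes "\<exists>y\<in>Z. k y < k x"
  shows "death k Z m x \<le> d \<longleftrightarrow> (\<forall>y\<in>Z. k y < k x \<longrightarrow> m x y \<le> d)"
  unfolding death_def using assms finite by (subst Max_le_iff) auto

lemma le_death_iff:
  assumes "\<exists>y\<in>Z. k y < k x"
  shows "d \<le> death k Z m x \<longleftrightarrow> (\<exists>y\<in>Z. k y < k x \<and> d \<le> m x y)"
  unfolding death_def using assms finite by (subst Max_ge_iff) auto

text \<open>A bar ends at \<open>d\<close> when its element heads its component just before
  \<open>d\<close> but no longer at \<open>d\<close>, so differences of elder counts give the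
  multiplicities. For \<open>b = d\<close> the first count becomes that of all elements of birth
  \<open>b\<close>, since nothing merges above its birth.\<close>

lemma count_bars:
  "count (bars k Z f m) (b, d) =
     (if d < b then card (elders k Z f m {d<..} b) - card (elders k Z f m {d..} b)
      else if b = d then card {x \<in> Z. f x = b} - card (elders k Z f m {b..} b)
      else 0)"
proof -
  have "count (bars k Z f m) (b, d) =
      card {x \<in> Z. (\<exists>y\<in>Z. k y < k x) \<and> f x = b \<and> death k Z m x = d}"
  proof -
    have "(\<lambda>x. (f x, death k Z m x)) -` {(b, d)} \<inter> {x \<in> Z. \<exists>y\<in>Z. k y < k x} =
        {x \<in> Z. (\<exists>y\<in>Z. k y < k x) \<and> f x = b \<and> death k Z m x = d}"
      by blast
    then show ?thesis unfolding bars_def count_image_mset using finite by simp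
  qed
  \<comment> \<open>The eldest element of all lies in both elder sets, so it drops out of the
    difference just as it is left out of the bars.\<close>
  also have "{x \<in> Z. (\<exists>y\<in>Z. k y < k x) \<and> f x = b \<and> death k Z m x = d} =
      elders k Z f m {d<..} b - elders k Z f m {d..} b"
  proof (rule set_eqI)
    fix x
    have "death k Z m x = d \<longleftrightarrow> (\<exists>y\<in>Z. k y < k x \<and> d \<le> m x y) \<and> \<not> (\<exists>y\<in>Z. k y < k x \<and> d < m x y)"
      if "\<exists>y\<in>Z. k y < k x"
    proof -
      have "death k Z m x \<le> d \<longleftrightarrow> \<not> (\<exists>y\<in>Z. k y < k x \<and> d < m x y)"
        unfolding death_le_iff[OF that] by (meson not_less)
      then show ?thesis using le_death_iff[OF that, of d] by (metis order_antisym_conv order_refl)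
    qed
    then show "x \<in> {x \<in> Z. (\<exists>y\<in>Z. k y < k x) \<and> f x = b \<and> death k Z m x = d} \<longleftrightarrow>
        x \<in> elders k Z f m {d<..} b - elders k Z f m {d..} b"
      unfolding elders_def by (simp only: mem_Collect_eq Diff_iff greaterThan_iff atLeast_iff) blast
  qed
  also have "card \<dots> = card (elders k Z f m {d<..} b) - card (elders k Z f m {d..} b)"
    using finite by (intro card_Diff_subset) (auto simp: elders_def)
  finally have *: "count (bars k Z f m) (b, d) = \<dots>" .
  have "elders k Z f m {d<..} b = {x \<in> Z. f x = b}" if "b \<le> d"
    using that unfolding elders_def by (fastforce dest: le)
  moreover have "elders k Z f m {d..} b = {x \<in> Z. f x = b}" if "b < d"
    using that unfolding elders_def by (fastforce dest: le)
  ultimately show ?thesis unfolding * by auto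
qed

text \<open>The common value is the number of classes of the relation \<open>m x y \<in> U\<close>
  whose highest birth is \<open>b\<close>, a number in which no ranking occurs.\<close>

lemma elders_card_unique:
  assumes k: "ranking k Z f" "ranking k' Z f" and U: "\<And>u v. u \<in> U \<Longrightarrow> u \<le> v \<Longrightarrow> v \<in> U" and b: "b \<in> U"
  shows "card (elders k Z f m U b) = card (elders k' Z f m U b)"
proof -
  \<comment> \<open>The alternative \<open>y = x\<close> is added because \<open>m x x\<close> may
    lie outside \<open>U\<close> even when \<open>f x\<close> lies in \<open>U\<close>.\<close>
  define \<kappa> where "\<kappa> x = {y \<in> Z. y = x \<or> m x y \<in> U}" for x
  let ?\<C> = "\<kappa> ` {x \<in> Z. f x \<in> U}"
  define \<beta> where "\<beta> C = Max (f ` C)" for C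
  have trans: "m x z \<in> U" if "x \<in> Z" "y \<in> Z" "z \<in> Z" "m x y \<in> U" "m y z \<in> U" for x y z
    using ultra[OF that(1-3)] that(4,5) U by (metis min_def)
  have eq: "\<kappa> x = \<kappa> y \<longleftrightarrow> m x y \<in> U" if "x \<in> Z" "y \<in> Z" "x \<noteq> y" for x y
  proof
    assume "\<kappa> x = \<kappa> y"
    then have "y \<in> \<kappa> x" using that by (simp add: \<kappa>_def)
    then show "m x y \<in> U" using that by (simp add: \<kappa>_def)
  next
    assume xy: "m x y \<in> U"
    then have yx: "m y x \<in> U" using sym that by simp
    show "\<kappa> x = \<kappa> y"
      unfolding \<kappa>_def using trans[of x y] trans[of y x] xy yx that by auto
  qed
  have self: "x \<in> \<kappa> x" if "x \<in> Z" for x using that by (simp add: \<kappa>_def)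
  have fin: "finite (\<kappa> x)" for x using finite by (simp add: \<kappa>_def)
  have \<beta>1: "f x \<le> \<beta> (\<kappa> x)" if "x \<in> Z" for x
    unfolding \<beta>_def using self[OF that] fin by (intro Max_ge) auto
  have \<beta>2: "\<exists>x\<in>Z. f x \<in> U \<and> \<kappa> x = C \<and> \<beta> C = f x" if C: "C \<in> ?\<C>" for C
  proof -
    obtain x where x: "x \<in> Z" "f x \<in> U" "C = \<kappa> x" using C by blast
    have "\<beta> C \<in> f ` C" unfolding \<beta>_def using x fin self by (intro Max_in) auto
    then obtain y where y: "y \<in> C" "\<beta> C = f y" by blast
    then have "y \<in> Z" "y = x \<or> m x y \<in> U" using x by (auto simp: \<kappa>_def)
    then show ?thesis using x y eq[of x y] le_both[of x y] U by (metis (no_types, lifting))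
  qed
  have "card (elders k Z f m U b) = card {C \<in> ?\<C>. \<beta> C = b}" if "ranking k Z f" for k
    by (rule card_elders[OF that finite U le_both b]) (use eq \<beta>1 \<beta>2 in auto)
  then show ?thesis using k by simp
qed

lemma bars_unique:
  assumes "ranking k Z f" "ranking k' Z f"
  shows "bars k Z f m = bars k' Z f m"
proof (rule multiset_eqI)
  fix p :: "real \<times> real"
  obtain b d where p: "p = (b, d)" by (cases p)
  have "card (elders k Z f m U b) = card (elders k' Z f m U b)"
    if "b \<in> U" "U = {d<..} \<or> U = {d..} \<or> U = {b..}" for U
    by (rule elders_card_unique[OF assms]) (use that in auto)
  then show "count (bars k Z f m) p = count (bars k' Z f m) p"
    unfolding p count_bars by (cases "b = d") simp_all
qed

end

section \<open>Stability of bars under changes of births and merge levels\<close>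

lemma rel_mset_bars:
  assumes "\<And>x. \<lbrakk>x \<in> Z; \<exists>y\<in>Z. k y < k x\<rbrakk> \<Longrightarrow> R (f x, death k Z m x) (f' x, death k Z m' x)"
  shows "rel_mset R (bars k Z f m) (bars k Z f' m')"
\<comment> \<open>For an infinite index set \<open>mset_set\<close> is empty, and so are both
  multisets of bars.\<close>
proof (cases "finite {x \<in> Z. \<exists>y\<in>Z. k y < k x}")
  case True
  then show ?thesis
    unfolding bars_def multiset.rel_map using assms by (intro multiset.rel_refl_strong) auto
qed (simp add: bars_def)

lemma bars_change_births:
  assumes f: "merge_tree Z f m" and g: "merge_tree Z g m"
    and fg: "\<And>x. x \<in> Z \<Longrightarrow> \<bar>f x - g x\<bar> \<le> \<epsilon>"
    and k: "ranking k Z f" "ranking k' Z g"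
  shows "rel_mset (\<lambda>p q. \<bar>fst p - fst q\<bar> \<le> \<epsilon> \<and> snd p = snd q) (bars k Z f m) (bars k' Z g m)"
proof -
  interpret f: merge_tree Z f m by (fact f)
  interpret g: merge_tree Z g m by (fact g)
  define h where "h t x = (1 - t) * f x + t * g x" for t x
  define R where "R c p q \<longleftrightarrow> \<bar>fst p - fst q\<bar> \<le> c * \<epsilon> \<and> snd p = snd q" for c and p q :: "real \<times> real"
  have tree: "merge_tree Z (h t) m" if "0 \<le> t" "t \<le> 1" for t
  proof
    fix x y assume xy: "x \<in> Z" "y \<in> Z"
    have "(1 - t) * m x y + t * m x y \<le> h t x"
      unfolding h_def using that f.le[OF xy] g.le[OF xy] by (intro add_mono mult_left_mono) auto
    then show "m x y \<le> h t x" by (simp add: algebra_simps)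
  qed (use f.finite f.sym f.ultra in auto)
  have h_diff: "\<bar>h a x - h b x\<bar> \<le> (b - a) * \<epsilon>" if "x \<in> Z" "a \<le> b" for a b x
  proof -
    have "h a x - h b x = (b - a) * (f x - g x)" by (simp add: h_def algebra_simps)
    then show ?thesis using fg[OF that(1)] that(2) by (simp add: abs_mult mult_left_mono)
  qed
  \<comment> \<open>All rankings are quantified so that pieces of the interpolation can be chained.
    The bounds on \<open>a\<close> and \<open>b\<close> are premises inside \<open>P\<close> because
    the short intervals considered below may stick out of the unit interval, where
    \<open>h t\<close> need not dominate \<open>m\<close>.\<close>
  define P where "P a b \<longleftrightarrow> (\<forall>k k'. 0 \<le> a \<longrightarrow> b \<le> 1 \<longrightarrow> ranking k Z (h a) \<longrightarrow> ranking k' Z (h b) \<longrightarrow>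
     rel_mset (R (b - a)) (bars k Z (h a) m) (bars k' Z (h b) m))" for a b
  have P_trans: "P a c" if P: "P a b" "P b c" "a \<le> b" "b \<le> c" for a b c
    unfolding P_def
  proof (intro allI impI)
    fix k k' assume H: "0 \<le> a" "c \<le> 1" "ranking k Z (h a)" "ranking k' Z (h c)"
    obtain k'' where "ranking k'' Z (h b)" using exists_ranking[OF f.finite] by blast
    then have "rel_mset (R (b - a) OO R (c - b)) (bars k Z (h a) m) (bars k' Z (h c) m)"
      using P H unfolding P_def by (intro rel_mset_OO[of _ _ "bars k'' Z (h b) m"]) auto
    then show "rel_mset (R (c - a)) (bars k Z (h a) m) (bars k' Z (h c) m)"
      by (rule multiset.rel_mono_strong) (auto simp: R_def algebra_simps)
  qed
  \<comment> \<open>If no strict comparison is reversed, one ranking \<open>l\<close> fits both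
    ends. It may replace \<open>k\<close> and \<open>k'\<close> without changing the bars, and then
    each element is matched with itself: its death stays and only its birth moves.\<close>
  have P_same: "P a b" if ab: "a \<le> b"
    and order: "\<And>x y. \<lbrakk>x \<in> Z; y \<in> Z; h a x < h a y\<rbrakk> \<Longrightarrow> h b x \<le> h b y" for a b
    unfolding P_def
  proof (intro allI impI)
    fix k k' assume H: "0 \<le> a" "b \<le> 1" "ranking k Z (h a)" "ranking k' Z (h b)"
    obtain l where l: "ranking l Z (h a)" "ranking l Z (h b)"
      using exists_common_ranking[of Z "h a" "h b", OF f.finite order] by blast
    have "bars k Z (h a) m = bars l Z (h a) m" "bars k' Z (h b) m = bars l Z (h b) m"
      by (intro merge_tree.bars_unique[OF tree] H l; use H ab in linarith)+
    then show "rel_mset (R (b - a)) (bars k Z (h a) m) (bars k' Z (h b) m)"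
      using h_diff[OF _ ab] by (simp add: rel_mset_bars R_def)
  qed
  \<comment> \<open>Bolzano's bisection principle: as \<open>P\<close> is transitive, it is enough
    to establish it on all short intervals around a given \<open>t\<close>.\<close>
  have "P 0 1"
  proof (rule Bolzano)
    fix t :: real
    have "\<exists>d>0. \<forall>s. \<bar>s - t\<bar> < d \<longrightarrow> (\<forall>z\<in>Z \<times> Z. h t (fst z) < h t (snd z) \<longrightarrow> h s (fst z) < h s (snd z))"
    proof -
      have "\<forall>\<^sub>F s in at t. \<forall>z\<in>Z \<times> Z. h t (fst z) < h t (snd z) \<longrightarrow> h s (fst z) < h s (snd z)"
      proof (intro eventually_ball_finite ballI)
        fix z
        have "(\<lambda>s. h s (snd z) - h s (fst z)) \<midarrow>t\<rightarrow> h t (snd z) - h t (fst z)"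
          unfolding h_def by (intro tendsto_intros)
        then show "\<forall>\<^sub>F s in at t. h t (fst z) < h t (snd z) \<longrightarrow> h s (fst z) < h s (snd z)"
          by (cases "h t (fst z) < h t (snd z)") (use order_tendstoD(1)[of _ _ _ 0] in fastforce)+
      qed (use f.finite in simp)
      then obtain d where "d > 0" "\<forall>s. s \<noteq> t \<and> \<bar>s - t\<bar> < d \<longrightarrow>
          (\<forall>z\<in>Z \<times> Z. h t (fst z) < h t (snd z) \<longrightarrow> h s (fst z) < h s (snd z))"
        unfolding eventually_at dist_real_def by auto
      then have "\<forall>z\<in>Z \<times> Z. h t (fst z) < h t (snd z) \<longrightarrow> h s (fst z) < h s (snd z)" if "\<bar>s - t\<bar> < d" for s
        using that by (cases "s = t") simp_all
      with \<open>d > 0\<close> show ?thesis by blast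
    qed
    then obtain d where d: "d > 0"
      "\<And>s x y. \<lbrakk>\<bar>s - t\<bar> < d; x \<in> Z; y \<in> Z; h t x < h t y\<rbrakk> \<Longrightarrow> h s x < h s y"
      by auto
    \<comment> \<open>Strict comparisons at \<open>t\<close> persist nearby, but a tie at
      \<open>t\<close> may split differently on the two sides, so the interval is cut at
      \<open>t\<close>. On the left part persistence is used in contrapositive form.\<close>
    have "P a b" if "a \<le> t" "t \<le> b" "b - a < d" for a b
    proof (rule P_trans)
      show "P a t"
      proof (rule P_same)
        fix x y assume "x \<in> Z" "y \<in> Z" "h a x < h a y"
        then show "h t x \<le> h t y" using d(2)[of a y x] that by linarith
      qed (use that in simp)
      show "P t b"
      proof (rule P_same)
        fix x y assume "x \<in> Z" "y \<in> Z" "h t x < h t y"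
        then show "h b x \<le> h b y" using d(2)[of b x y] that by linarith
      qed (use that in simp)
    qed (use that in auto)
    then show "\<exists>d>0. \<forall>a b. a \<le> t \<and> t \<le> b \<and> b - a < d \<longrightarrow> P a b" using d(1) by blast
  qed (use P_trans in auto)
  moreover have "h 0 = f" "h 1 = g" by (auto simp: h_def)
  ultimately show ?thesis unfolding P_def R_def using k by simp
qed

text \<open>
  The interpolation above needs a common merge level; the pointwise minimum of two merge levels is
  again ultrametric.
\<close>

theorem bars_stable:
  assumes f: "merge_tree Z f m" and g: "merge_tree Z g m'"
    and fg: "\<And>x. x \<in> Z \<Longrightarrow> \<bar>f x - g x\<bar> \<le> \<epsilon>"
    and mm': "\<And>x y. \<lbrakk>x \<in> Z; y \<in> Z\<rbrakk> \<Longrightarrow> \<bar>m x y - m' x y\<bar> \<le> \<eta>"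
    and k: "ranking k Z f" "ranking k' Z g"
  shows "rel_mset (\<lambda>p q. \<bar>fst p - fst q\<bar> \<le> \<epsilon> \<and> \<bar>snd p - snd q\<bar> \<le> \<eta>) (bars k Z f m) (bars k' Z g m')"
proof -
  interpret f: merge_tree Z f m by (fact f)
  interpret g: merge_tree Z g m' by (fact g)
  define \<mu> where "\<mu> x y = min (m x y) (m' x y)" for x y
  have \<mu>: "merge_tree Z f \<mu>" "merge_tree Z g \<mu>"
  proof -
    have "min (\<mu> x y) (\<mu> y z) \<le> \<mu> x z" if "x \<in> Z" "y \<in> Z" "z \<in> Z" for x y z
      using f.ultra[OF that] g.ultra[OF that] unfolding \<mu>_def by linarith
    moreover have "\<mu> x y \<le> f x" "\<mu> x y \<le> g x" "\<mu> x y = \<mu> y x" if "x \<in> Z" "y \<in> Z" for x y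
      using f.le[OF that] g.le[OF that] f.sym[OF that] g.sym[OF that] by (auto simp: \<mu>_def)
    ultimately show "merge_tree Z f \<mu>" "merge_tree Z g \<mu>"
      using f.finite by unfold_locales auto
  qed
  have death_mono: "death k Z \<mu> x \<le> death k Z \<nu> x \<and> death k Z \<nu> x \<le> death k Z \<mu> x + \<eta>"
    if x: "x \<in> Z" "\<exists>y\<in>Z. k y < k x" and \<nu>: "\<nu> = m \<or> \<nu> = m'" for x \<nu> and k :: "'a \<Rightarrow> nat"
  proof -
    have tree: "\<exists>h. merge_tree Z h \<nu>" using \<nu> f g by blast
    then obtain h where h: "merge_tree Z h \<nu>" by blast
    have 1: "\<mu> x y \<le> \<nu> x y" "\<nu> x y \<le> \<mu> x y + \<eta>" if "y \<in> Z" for y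
      using mm'[OF x(1) that] \<nu> by (auto simp: \<mu>_def)
    have "\<mu> x y \<le> death k Z \<nu> x" if "y \<in> Z" "k y < k x" for y
      using merge_tree.le_death_iff[OF h x(2)] 1(1) that by blast
    moreover have "\<nu> x y \<le> death k Z \<mu> x + \<eta>" if "y \<in> Z" "k y < k x" for y
    proof -
      have "\<mu> x y \<le> death k Z \<mu> x" using merge_tree.le_death_iff[OF \<mu>(1) x(2)] that by blast
      then show ?thesis using 1(2)[OF that(1)] by linarith
    qed
    ultimately show ?thesis
      using merge_tree.death_le_iff[OF \<mu>(1) x(2)] merge_tree.death_le_iff[OF h x(2)] by blast
  qed
  \<comment> \<open>The deaths first go down by at most \<open>\<eta>\<close> and later up by at
    most \<open>\<eta>\<close>. Because the two moves are in opposite directions, the total change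
    is at most \<open>\<eta>\<close> and not \<open>2 * \<eta>\<close>.\<close>
  let ?down = "\<lambda>p q :: real \<times> real. fst p = fst q \<and> snd q \<le> snd p \<and> snd p \<le> snd q + \<eta>"
  let ?mid = "\<lambda>p q :: real \<times> real. \<bar>fst p - fst q\<bar> \<le> \<epsilon> \<and> snd p = snd q"
  let ?up = "\<lambda>p q :: real \<times> real. fst p = fst q \<and> snd p \<le> snd q \<and> snd q \<le> snd p + \<eta>"
  have 1: "rel_mset ?down (bars k Z f m) (bars k Z f \<mu>)"
    by (rule rel_mset_bars) (use death_mono in auto)
  have 2: "rel_mset ?mid (bars k Z f \<mu>) (bars k' Z g \<mu>)"
    by (rule bars_change_births[OF \<mu> fg k])
  have 3: "rel_mset ?up (bars k' Z g \<mu>) (bars k' Z g m')"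
    by (rule rel_mset_bars) (use death_mono in auto)
  show ?thesis
    using rel_mset_OO[OF 1 rel_mset_OO[OF 2 3]] by (rule multiset.rel_mono_strong) auto
qed

subsection \<open>Distance functions along edges\<close>

locale based_graph =
  fixes G :: "('v, 'e) len_graph" and s :: "('v, 'e) point"
  assumes G: "metric_graph G" and s: "s \<in> points G"
begin

sublocale M: Metric_space "points G" "gdist G"
  by (rule Metric_space_gdist[OF G])

sublocale fin_digraph "underlying G"
  using G by (simp add: metric_graph_def)

lemma mtopology_eq: "M.mtopology = gtopology G"
  by (simp add: gtopology_def)

lemma topspace_gtopology [simp]: "topspace (gtopology G) = points G"
  by (simp flip: mtopology_eq)

lemma len_pos: "e \<in> arcs (underlying G) \<Longrightarrow> 0 < len G e"
  using G by (simp add: metric_graph_def)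

lemmas edge_point_points = edge_point_in_points[OF G]

lemma gdist_le_gpath:
  assumes "gpath G p q l"
  shows "gdist G p q \<le> l"
proof -
  have "bdd_below {l. gpath G p q l}" by (rule bdd_belowI[of _ 0]) (simp add: gpath_nonneg)
  then have "Inf {l. gpath G p q l} \<le> l" using assms by (intro cInf_lower) auto
  then show ?thesis using gpath_in_points[OF assms G] by (simp add: gdist_def)
qed

lemma gpath_less:
  assumes "p \<in> points G" "q \<in> points G" "gdist G p q < c"
  shows "\<exists>l<c. gpath G p q l"
proof -
  have "Inf {l. gpath G p q l} < c" using assms by (simp add: gdist_def)
  moreover have "{l. gpath G p q l} \<noteq> {}" using gpath_exists[OF G assms(1,2)] by blast
  ultimately obtain l where "l \<in> {l. gpath G p q l}" "l < c" using cInf_lessD by metis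
  then show ?thesis by blast
qed

lemma gdist_edge_le:
  assumes "e \<in> arcs (underlying G)" "a \<in> {0..len G e}" "b \<in> {0..len G e}"
  shows "gdist G (edge_point G e a) (edge_point G e b) \<le> \<bar>a - b\<bar>"
  using gdist_le_gpath[OF gpath_segment[OF G assms]] .

lemma continuous_map_edge_point:
  assumes "e \<in> arcs (underlying G)"
  shows "continuous_map (top_of_set {0..len G e}) (gtopology G) (edge_point G e)"
  unfolding mtopology_eq[symmetric] M.continuous_map_to_metric
proof (intro ballI allI impI)
  fix a \<epsilon> :: real assume a: "a \<in> topspace (top_of_set {0..len G e})" and "\<epsilon> > 0"
  show "\<exists>U. openin (top_of_set {0..len G e}) U \<and> a \<in> U \<and>
      (\<forall>b\<in>U. edge_point G e b \<in> M.mball (edge_point G e a) \<epsilon>)"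
  proof (intro exI conjI ballI)
    show "openin (top_of_set {0..len G e}) ({0..len G e} \<inter> ball a \<epsilon>)" by blast
    show "a \<in> {0..len G e} \<inter> ball a \<epsilon>" using a \<open>\<epsilon> > 0\<close> by simp
    fix b assume "b \<in> {0..len G e} \<inter> ball a \<epsilon>"
    then show "edge_point G e b \<in> M.mball (edge_point G e a) \<epsilon>"
      using a edge_point_points[OF assms] gdist_edge_le[OF assms, of a b]
      by (auto simp: dist_real_def)
  qed
qed

lemma connectedin_edge_image:
  assumes "e \<in> arcs (underlying G)" "A \<subseteq> {0..len G e}" "connected A"
  shows "connectedin (gtopology G) (edge_point G e ` A)"
  using assms connectedin_continuous_map_image[OF continuous_map_edge_point[OF assms(1)], of A]
  by (simp add: connectedin_subtopology)

lemma closedin_edge_image: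
  assumes "e \<in> arcs (underlying G)" "A \<subseteq> {0..len G e}" "compact A"
  shows "closedin (gtopology G) (edge_point G e ` A)"
proof -
  have "compactin (gtopology G) (edge_point G e ` A)"
    using assms image_compactin[OF _ continuous_map_edge_point[OF assms(1)], of A]
    by (simp add: compactin_subtopology)
  then show ?thesis
    using M.Hausdorff_space_mtopology by (simp add: mtopology_eq compactin_imp_closedin)
qed

lemma gdist_lipschitz:
  assumes "x \<in> points G" "y \<in> points G" "p \<in> points G"
  shows "\<bar>gdist G p x - gdist G p y\<bar> \<le> gdist G x y"
  using M.mdist_reverse_triangle[of x p y] assms by (simp add: M.commute)

lemma gdist_edge_lipschitz:
  assumes "e \<in> arcs (underlying G)" "a \<in> {0..len G e}" "b \<in> {0..len G e}"
  shows "\<bar>gdist G s (edge_point G e a) - gdist G s (edge_point G e b)\<bar> \<le> \<bar>a - b\<bar>"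
  using gdist_lipschitz[OF edge_point_points edge_point_points s, OF assms(1,2) assms(1,3)]
    gdist_edge_le[OF assms] by linarith

text \<open>
  A path from \<open>s\<close> reaches an interior point of a subarc avoiding \<open>s\<close> through one of its ends: raising
  the distance function on the subarc to its smaller end value keeps it 1-Lipschitz.
\<close>

lemma gdist_quasiconcave:
  assumes e: "e \<in> arcs (underlying G)" and t: "0 \<le> t1" "t1 < t" "t < t2" "t2 \<le> len G e"
    and off: "\<And>u. t1 < u \<Longrightarrow> u < t2 \<Longrightarrow> s \<noteq> Inner e u"
  shows "min (gdist G s (edge_point G e t1)) (gdist G s (edge_point G e t2))
    \<le> gdist G s (edge_point G e t)"
proof -
  let ?f = "gdist G s"
  define c where "c = min (?f (edge_point G e t1)) (?f (edge_point G e t2))"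
  define A :: "('v, 'e) point set" where "A = Inner e ` {t1<..<t2}"
  define \<phi> where "\<phi> x = (if x \<in> A then max (?f x) c else ?f x)" for x
  have in_A: "edge_point G e' a \<in> A \<longleftrightarrow> e' = e \<and> t1 < a \<and> a < t2"
    if "a \<in> {0..len G e'}" for e' a
    using that t by (auto simp: A_def edge_point_def)
  define h where "h a = ?f (edge_point G e a)" for a
  have h: "\<bar>h a - h b\<bar> \<le> \<bar>a - b\<bar>" if "a \<in> {0..len G e}" "b \<in> {0..len G e}" for a b
    using gdist_edge_lipschitz[OF e that] by (simp add: h_def)
  have c: "c \<le> h t1" "c \<le> h t2" by (auto simp: c_def h_def)
  \<comment> \<open>A segment leaving the subarc passes through one of its ends, where
    \<open>c \<le> h\<close> makes the raised and the original function agree.\<close>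
  have glue: "\<bar>max (h a) c - h b\<bar> \<le> \<bar>a - b\<bar>"
    if "a \<in> {0..len G e}" "b \<in> {0..len G e}" "t1 < a" "a < t2" "\<not> (t1 < b \<and> b < t2)" for a b
  proof (cases "b \<le> t1")
    case True
    then show ?thesis using h[of a t1] h[of t1 b] h[of a b] c that t by auto
  next
    case False
    then show ?thesis using h[of a t2] h[of t2 b] h[of a b] c that t by auto
  qed
  have "\<bar>\<phi> (edge_point G e' a) - \<phi> (edge_point G e' b)\<bar> \<le> \<bar>a - b\<bar>"
    if e': "e' \<in> arcs (underlying G)" and ab: "a \<in> {0..len G e'}" "b \<in> {0..len G e'}" for e' a b
  proof (cases "e' = e")
    case True
    have \<phi>: "\<phi> (edge_point G e u) = (if t1 < u \<and> u < t2 then max (h u) c else h u)"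
      if "u \<in> {0..len G e}" for u
      using in_A[of u e] that by (simp add: \<phi>_def h_def)
    have *: "a \<in> {0..len G e}" "b \<in> {0..len G e}" using ab by (simp_all add: True)
    have "\<bar>max (h a) c - max (h b) c\<bar> \<le> \<bar>a - b\<bar>" using h[OF *] by linarith
    then show ?thesis
      unfolding True \<phi>[OF *(1)] \<phi>[OF *(2)]
      using glue[OF *] glue[OF *(2,1)] h[OF *] by (simp add: abs_minus_commute)
  next
    case False
    then show ?thesis
      using in_A[OF ab(1)] in_A[OF ab(2)] gdist_edge_lipschitz[OF e' ab] by (simp add: \<phi>_def)
  qed
  then have lip: "\<bar>\<phi> p - \<phi> q\<bar> \<le> l" if "gpath G p q l" for p q l
    using gpath_lipschitz[OF that] by blast
  let ?x = "edge_point G e t"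
  have x: "?x \<in> points G" using edge_point_points[OF e] t by simp
  have "s \<notin> A" unfolding A_def
    by (rule notI, elim imageE) (simp add: off)
  then have "\<phi> s = 0" using s by (simp add: \<phi>_def)
  moreover have "c \<le> \<phi> ?x" using in_A[of t e] t by (simp add: \<phi>_def)
  ultimately have "c \<le> l" if "gpath G s ?x l" for l
    using lip[OF that] by linarith
  then have "c \<le> ?f ?x"
    using gpath_less[OF s x, of c] by (meson not_le)
  then show ?thesis by (simp add: c_def)
qed

subsection \<open>Unimodal pieces\<close>

text \<open>Cutting every edge at \<open>s\<close> leaves closed arcs on which the distance from \<open>s\<close> is quasiconcave.\<close>

definition cut :: "'e \<Rightarrow> real" where
  "cut e = (case s of Inner e' t \<Rightarrow> if e' = e then t else 0 | Node v \<Rightarrow> 0)"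

text \<open>The singletons cover a graph that consists of one node without edges. On an edge without
  \<open>s\<close> in its interior \<open>cut e = 0\<close>, and the first arc shrinks to the
  tail.\<close>

definition pieces :: "('v, 'e) point set set" where
  "pieces = (\<lambda>v. {Node v}) ` verts (underlying G) \<union>
     (\<lambda>e. edge_point G e ` {0..cut e}) ` arcs (underlying G) \<union>
     (\<lambda>e. edge_point G e ` {cut e..len G e}) ` arcs (underlying G)"

text \<open>If \<open>cut e = 0\<close>, then \<open>Inner e (cut e)\<close> is not a point of the
  graph; the set only has to be finite and to contain every point shared by two distinct
  pieces.\<close>

definition joints :: "('v, 'e) point set" where
  "joints = Node ` verts (underlying G) \<union> (\<lambda>e. Inner e (cut e)) ` arcs (underlying G)"

lemma finite_pieces: "finite pieces" and finite_joints: "finite joints"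
  by (auto simp: pieces_def joints_def)

lemma cut_bounds: "e \<in> arcs (underlying G) \<Longrightarrow> 0 \<le> cut e \<and> cut e \<le> len G e"
  using s len_pos[of e] by (auto simp: cut_def points_def split: point.splits)

lemma cut_off: "\<not> (u = cut e) \<Longrightarrow> s \<noteq> Inner e u"
  by (auto simp: cut_def)

lemma piece_cases:
  assumes "J \<in> pieces"
  obtains (node) v where "v \<in> verts (underlying G)" "J = {Node v}"
    | (edge) e l r where "e \<in> arcs (underlying G)" "0 \<le> l" "l \<le> r" "r \<le> len G e"
        "J = edge_point G e ` {l..r}" "\<And>u. l < u \<Longrightarrow> u < r \<Longrightarrow> s \<noteq> Inner e u"
        "l = 0 \<and> r = cut e \<or> l = cut e \<and> r = len G e"
proof -
  consider v where "v \<in> verts (underlying G)" "J = {Node v}"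
    | e where "e \<in> arcs (underlying G)" "J = edge_point G e ` {0..cut e}"
    | e where "e \<in> arcs (underlying G)" "J = edge_point G e ` {cut e..len G e}"
    using assms unfolding pieces_def by blast
  then show thesis
  proof cases
    case (2 e)
    show thesis
      by (rule edge[of e 0 "cut e"]) (use 2 cut_bounds[of e] cut_off[of _ e] in auto)
  next
    case (3 e)
    show thesis
      by (rule edge[of e "cut e" "len G e"]) (use 3 cut_bounds[of e] cut_off[of _ e] in auto)
  qed (use node in blast)
qed

lemma Union_pieces: "\<Union>pieces = points G"
proof (intro subset_antisym subsetI)
  fix x assume "x \<in> \<Union>pieces"
  then obtain J where J: "J \<in> pieces" "x \<in> J" by blast
  from J(1) show "x \<in> points G"
  proof (cases rule: piece_cases)
    case (node v)
    then show ?thesis using J(2) by (simp add: points_def)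
  next
    case (edge e l r)
    then show ?thesis using J(2) edge_point_points[of e] by auto
  qed
next
  fix x assume x: "x \<in> points G"
  show "x \<in> \<Union>pieces"
  proof (cases x)
    case (Node v)
    then show ?thesis using x by (auto simp: points_def pieces_def)
  next
    case (Inner e t)
    then have e: "e \<in> arcs (underlying G)" "0 < t" "t < len G e" using x by (auto simp: points_def)
    then have "x = edge_point G e t" using Inner by (simp add: edge_point_def)
    moreover have "t \<in> {0..cut e} \<or> t \<in> {cut e..len G e}" using e by auto
    ultimately have "x \<in> edge_point G e ` {0..cut e} \<or> x \<in> edge_point G e ` {cut e..len G e}" by blast
    moreover have "edge_point G e ` {0..cut e} \<in> pieces" "edge_point G e ` {cut e..len G e} \<in> pieces"
      unfolding pieces_def using e(1) by (auto intro: imageI)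
    ultimately show ?thesis by (meson UnionI)
  qed
qed

lemma piece_subset: "J \<in> pieces \<Longrightarrow> J \<subseteq> points G"
  using Union_pieces by blast

lemma closedin_piece:
  assumes J: "J \<in> pieces"
  shows "closedin (gtopology G) J"
  using J
proof (cases rule: piece_cases)
  case (node v)
  then have "Node v \<in> points G" by (simp add: points_def)
  then show ?thesis
    using node(2) closedin_Hausdorff_singleton[OF M.Hausdorff_space_mtopology] unfolding mtopology_eq by simp
next
  case (edge e l r)
  then show ?thesis using closedin_edge_image[of e "{l..r}"] by auto
qed

text \<open>An interior point of an edge determines the edge and the parameter, so it can only be
  shared by the two arcs of that edge, which meet at the cut.\<close>

lemma piece_inter_joint:
  assumes J: "J \<in> pieces" "J' \<in> pieces" "J \<noteq> J'" and x: "x \<in> J" "x \<in> J'"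
  shows "x \<in> joints"
proof (cases x)
  case (Node v)
  then show ?thesis using piece_subset[OF J(1)] x(1) by (auto simp: points_def joints_def)
next
  case (Inner e t)
  have *: "e \<in> arcs (underlying G) \<and> 0 < t \<and> t < len G e \<and>
      (K = edge_point G e ` {0..cut e} \<and> t \<le> cut e \<or> K = edge_point G e ` {cut e..len G e} \<and> cut e \<le> t)"
    if K: "K \<in> pieces" "x \<in> K" for K
    using K(1)
  proof (cases rule: piece_cases)
    case (edge e' l r)
    then obtain u where u: "l \<le> u" "u \<le> r" "Inner e t = edge_point G e' u"
      using K(2) Inner by auto
    then have "u \<noteq> 0" "u \<noteq> len G e'" "e' = e" "u = t"
      unfolding edge_point_def by (metis point.distinct(1) point.inject(2))+
    then show ?thesis using edge(1,2,4,5,7) u(1,2) by auto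
  qed (use K Inner in simp)
  have "t = cut e"
    using *[OF J(1) x(1)] *[OF J(2) x(2)] J(3) by (metis order_antisym)
  then show ?thesis using *[OF J(1) x(1)] Inner by (auto simp: joints_def)
qed

text \<open>By quasiconcavity the parameters of an arc whose values lie in an up-closed set form an
  interval.\<close>

lemma connectedin_piece_superlevel:
  assumes J: "J \<in> pieces" and U: "\<And>u v. u \<in> U \<Longrightarrow> u \<le> v \<Longrightarrow> v \<in> U"
  shows "connectedin (gtopology G) {x \<in> J. gdist G s x \<in> U}"
  using J
proof (cases rule: piece_cases)
  case (node v)
  then have "Node v \<in> points G" by (simp add: points_def)
  then have *: "connectedin (gtopology G) {Node v}" by simp
  have "{x \<in> J. gdist G s x \<in> U} = {} \<or> {x \<in> J. gdist G s x \<in> U} = {Node v}"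
    using node by auto
  then show ?thesis by (elim disjE) (simp_all only: * connectedin_empty)
next
  case (edge e l r)
  let ?h = "\<lambda>t. gdist G s (edge_point G e t)"
  let ?A = "{t \<in> {l..r}. ?h t \<in> U}"
  have "is_interval ?A"
    unfolding is_interval_1
  proof (intro ballI allI impI, elim conjE)
    fix a b t assume ab: "a \<in> ?A" "b \<in> ?A" "a \<le> t" "t \<le> b"
    then consider "t = a" | "t = b" | "a < t" "t < b" by linarith
    then show "t \<in> ?A"
    proof cases
      case 3
      have "min (?h a) (?h b) \<le> ?h t"
        by (rule gdist_quasiconcave[OF edge(1)]) (use 3 ab edge(2-4,6) in auto)
      moreover have "min (?h a) (?h b) \<in> U" using ab by (auto simp: min_def)
      ultimately have "?h t \<in> U" by (rule U[rotated])
      then show ?thesis using ab by simp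
    qed (use ab in simp_all)
  qed
  then have "connectedin (gtopology G) (edge_point G e ` ?A)"
    using edge by (intro connectedin_edge_image) (auto simp: is_interval_connected_1)
  also have "edge_point G e ` ?A = {x \<in> J. gdist G s x \<in> U}" using edge(5) by auto
  finally show ?thesis .
qed

lemma piece_peak:
  assumes J: "J \<in> pieces"
  shows "\<exists>p\<in>J. \<forall>x\<in>J. gdist G s x \<le> gdist G s p"
  using J
proof (cases rule: piece_cases)
  case (edge e l r)
  let ?h = "\<lambda>t. gdist G s (edge_point G e t)"
  have "continuous_on {l..r} ?h"
    unfolding continuous_on_iff
  proof (intro ballI allI impI)
    fix a \<epsilon> :: real assume a: "a \<in> {l..r}" "\<epsilon> > 0"
    have "dist (?h b) (?h a) < \<epsilon>" if "b \<in> {l..r}" "dist b a < \<epsilon>" for b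
      using gdist_edge_lipschitz[OF edge(1), of b a] edge(2,4) a that by (simp add: dist_real_def)
    then show "\<exists>\<delta>>0. \<forall>b\<in>{l..r}. dist b a < \<delta> \<longrightarrow> dist (?h b) (?h a) < \<epsilon>"
      using a(2) by blast
  qed
  then obtain t where "t \<in> {l..r}" "\<forall>u\<in>{l..r}. ?h u \<le> ?h t"
    using continuous_attains_sup[of "{l..r}" ?h] edge(3) by auto
  then show ?thesis using edge(5) by auto
qed auto

subsection \<open>Merge levels of distance functions\<close>

definition level :: "real set \<Rightarrow> ('v, 'e) point set" where
  "level U = {x \<in> points G. gdist G s x \<in> U}"

definition joined :: "real set \<Rightarrow> ('v, 'e) point \<Rightarrow> ('v, 'e) point \<Rightarrow> bool" where
  "joined U = connected_component_of (subtopology (gtopology G) (level U))"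

text \<open>One step of a chain through pieces; chains are the combinatorial counterpart of
  \<open>joined\<close>.\<close>

definition adj :: "real set \<Rightarrow> (('v, 'e) point \<times> ('v, 'e) point) set" where
  "adj U = {(x, y). \<exists>J\<in>pieces. x \<in> J \<and> y \<in> J \<and> gdist G s x \<in> U \<and> gdist G s y \<in> U}"

lemma superlevel_eq: "superlevel G (gdist G s) d = level {d..}"
  by (simp add: superlevel_def level_def)

lemma strict_superlevel_eq: "strict_superlevel G (gdist G s) d = level {d<..}"
proof (intro subset_antisym subsetI)
  fix x assume "x \<in> level {d<..}"
  then have "x \<in> superlevel G (gdist G s) (gdist G s x)" "gdist G s x \<in> {d<..}"
    by (simp_all add: level_def superlevel_def)
  then show "x \<in> strict_superlevel G (gdist G s) d" unfolding strict_superlevel_def by (rule UN_I[rotated])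
qed (auto simp: strict_superlevel_def superlevel_def level_def)

lemma level_subset: "level U \<subseteq> points G"
  by (auto simp: level_def)

lemma joined_iff_connectedin: "joined U x y \<longleftrightarrow> (\<exists>T. connectedin (gtopology G) T \<and> T \<subseteq> level U \<and> x \<in> T \<and> y \<in> T)"
  by (auto simp: joined_def connected_component_of_def connectedin_subtopology)

lemma joined_level: "joined U x y \<Longrightarrow> x \<in> level U \<and> y \<in> level U"
  by (auto simp: joined_iff_connectedin)

lemma joined_refl: "x \<in> level U \<Longrightarrow> joined U x x"
  using level_subset by (auto simp: joined_def connected_component_of_refl)

lemma joined_sym: "joined U x y \<Longrightarrow> joined U y x"
  by (simp add: joined_def connected_component_of_sym)

lemma joined_trans: "joined U x y \<Longrightarrow> joined U y z \<Longrightarrow> joined U x z"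
  unfolding joined_def by (rule connected_component_of_trans)

lemma joined_mono: "joined U x y \<Longrightarrow> U \<subseteq> V \<Longrightarrow> joined V x y"
  unfolding joined_def by (erule connected_component_of_mono) (auto simp: level_def)

text \<open>The distance function is 1-Lipschitz along edges, so it drops by at most
  \<open>l\<close> on a path of length \<open>l\<close>, and the traversed segments are
  connected.\<close>

lemma joined_gpath:
  assumes "gpath G p q l" "c \<le> gdist G s p - l"
  shows "joined {c..} p q"
  using assms
proof (induction rule: gpath.induct)
  case (refl p)
  then show ?case by (intro joined_refl) (simp add: level_def)
next
  case (step e a b q l)
  let ?A = "edge_point G e ` {min a b..max a b}"
  have sub: "{min a b..max a b} \<subseteq> {0..len G e}" using step.hyps(2,3) by auto
  have "connectedin (gtopology G) ?A"
    using step.hyps(1) sub by (intro connectedin_edge_image) auto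
  moreover have "?A \<subseteq> level {c..}"
  proof (intro subsetI, elim imageE)
    fix x u assume u: "x = edge_point G e u" "u \<in> {min a b..max a b}"
    then have u': "u \<in> {0..len G e}" using sub by blast
    have "gdist G s (edge_point G e a) - \<bar>a - b\<bar> \<le> gdist G s x"
      using gdist_edge_lipschitz[OF step.hyps(1,2) u'] u by (auto simp: min_def max_def split: if_splits)
    then show "x \<in> level {c..}"
      using step.prems gpath_nonneg[OF step.hyps(4)] u(1) edge_point_points[OF step.hyps(1) u']
      by (simp add: level_def)
  qed
  moreover have "edge_point G e a \<in> ?A" "edge_point G e b \<in> ?A" by auto
  ultimately have "joined {c..} (edge_point G e a) (edge_point G e b)"
    unfolding joined_iff_connectedin by (intro exI[of _ ?A] conjI)
  moreover have "joined {c..} (edge_point G e b) q"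
    using step.IH step.prems gdist_edge_lipschitz[OF step.hyps(1,2,3)] by simp
  ultimately show ?case by (rule joined_trans)
qed

text \<open>A chain gives a connection because each piece meets the superlevel set in a connected
  set. Conversely, the pieces reached by chains from \<open>x\<close> and the remaining pieces form
  two closed sets, as there are finitely many, which cover \<open>T\<close> and are disjoint on
  \<open>T\<close>; connectedness leaves only the first.\<close>

lemma joined_iff_adj:
  assumes U: "\<And>u v. u \<in> U \<Longrightarrow> u \<le> v \<Longrightarrow> v \<in> U" and x: "x \<in> level U"
  shows "joined U x y \<longleftrightarrow> (x, y) \<in> (adj U)\<^sup>*"
proof
  assume "(x, y) \<in> (adj U)\<^sup>*"
  then show "joined U x y"
  proof (induction rule: rtrancl_induct)
    case base
    show ?case by (rule joined_refl[OF x])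
  next
    case (step y z)
    from step.hyps(2) obtain J where J: "J \<in> pieces" "y \<in> J" "z \<in> J" "gdist G s y \<in> U" "gdist G s z \<in> U"
      unfolding adj_def by auto
    let ?T = "{x \<in> J. gdist G s x \<in> U}"
    have "connectedin (gtopology G) ?T" using J(1) U by (rule connectedin_piece_superlevel)
    moreover have "?T \<subseteq> level U" using piece_subset[OF J(1)] by (auto simp: level_def)
    ultimately have "joined U y z"
      unfolding joined_iff_connectedin using J(2-5) by (intro exI[of _ ?T] conjI) simp_all
    with step.IH show ?case by (rule joined_trans)
  qed
next
  assume "joined U x y"
  then obtain T where T: "connectedin (gtopology G) T" "T \<subseteq> level U" "x \<in> T" "y \<in> T"
    unfolding joined_iff_connectedin by blast
  define P where "P J \<longleftrightarrow> (\<exists>z\<in>J. z \<in> level U \<and> (x, z) \<in> (adj U)\<^sup>*)" for J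
  let ?A = "\<Union>{J \<in> pieces. P J}" and ?B = "\<Union>{J \<in> pieces. \<not> P J}"
  have closed: "closedin (gtopology G) ?A" "closedin (gtopology G) ?B"
    using finite_pieces closedin_piece by (auto intro!: closedin_Union)
  have C: "(x, z) \<in> (adj U)\<^sup>*" if "z \<in> J" "J \<in> pieces" "P J" "z \<in> level U" for z J
  proof -
    obtain w where w: "w \<in> J" "w \<in> level U" "(x, w) \<in> (adj U)\<^sup>*"
      using \<open>P J\<close> unfolding P_def by blast
    have "(w, z) \<in> adj U" using w that by (auto simp: adj_def level_def)
    then show ?thesis using w(3) by auto
  qed
  have cover: "T \<subseteq> ?A \<union> ?B" using T(2) level_subset Union_pieces by blast
  have "?A \<inter> ?B \<inter> T = {}"
  proof (rule equals0I)
    fix z assume z: "z \<in> ?A \<inter> ?B \<inter> T"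
    then obtain J J' where J: "J \<in> pieces" "P J" "z \<in> J" "J' \<in> pieces" "\<not> P J'" "z \<in> J'" by blast
    have "z \<in> level U" using z T(2) by blast
    with J C show False unfolding P_def by blast
  qed
  moreover have "x \<in> ?A"
  proof -
    obtain J where "J \<in> pieces" "x \<in> J" using x level_subset Union_pieces by blast
    then show ?thesis using x unfolding P_def by blast
  qed
  then have "?A \<inter> T \<noteq> {}" using T(3) by blast
  moreover have "\<not> (\<exists>E1 E2. closedin (gtopology G) E1 \<and> closedin (gtopology G) E2 \<and>
      T \<subseteq> E1 \<union> E2 \<and> E1 \<inter> E2 \<inter> T = {} \<and> E1 \<inter> T \<noteq> {} \<and> E2 \<inter> T \<noteq> {})"
    using T(1) unfolding connectedin_closedin by (rule conjunct2)
  ultimately have "?B \<inter> T = {}"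
    using closed cover by (rule_tac ccontr) (erule notE, intro exI[of _ ?A] exI[of _ ?B] conjI)
  then have "y \<in> ?A" using cover T(4) by blast
  then obtain J where "J \<in> pieces" "P J" "y \<in> J" by blast
  then show "(x, y) \<in> (adj U)\<^sup>*" using C T(2,4) by blast
qed

lemma joined_atLeast_iff_adj: "x \<in> level {d..} \<Longrightarrow> joined {d..} x y \<longleftrightarrow> (x, y) \<in> (adj {d..})\<^sup>*"
  by (rule joined_iff_adj) simp_all

lemma joined_greaterThan_iff_adj: "x \<in> level {d<..} \<Longrightarrow> joined {d<..} x y \<longleftrightarrow> (x, y) \<in> (adj {d<..})\<^sup>*"
  by (rule joined_iff_adj) simp_all

text \<open>Pieces meet in finitely many joints, so chains of pieces have finitely many relevant levels.\<close>

lemma adj_through_joints: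
  assumes B: "joints \<subseteq> B" "x \<in> B" "y \<in> B" and xy: "(x, y) \<in> (adj U)\<^sup>*"
  shows "(x, y) \<in> (adj U \<inter> B \<times> B)\<^sup>*"
proof -
  let ?R = "(adj U \<inter> B \<times> B)\<^sup>*"
  define link where "link b z J \<longleftrightarrow> J \<in> pieces \<and> b \<in> J \<and> z \<in> J \<and> gdist G s b \<in> U \<and> gdist G s z \<in> U" for b z J
  have link_adj: "(b, z) \<in> adj U \<inter> B \<times> B" if "link b z J" "b \<in> B" "z \<in> B" for b z J
    using that by (auto simp: link_def adj_def)
  \<comment> \<open>Invariant: the current point shares a piece with some \<open>b\<close> that was
    reached inside \<open>B\<close>. Whenever the chain changes its piece, the current point lies in
    two pieces, hence is a joint, and becomes the new \<open>b\<close>.\<close>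
  have "y = x \<or> (\<exists>b\<in>B. \<exists>J. (x, b) \<in> ?R \<and> link b y J)"
    using xy
  proof (induction rule: rtrancl_induct)
    case (step z w)
    from step.hyps(2) obtain J' where J': "link z w J'" unfolding adj_def link_def by auto
    from step.IH show ?case
    proof (elim disjE bexE exE conjE)
      assume "z = x"
      then show ?thesis using J' B(2) by blast
    next
      fix b J assume b: "b \<in> B" "(x, b) \<in> ?R" "link b z J"
      show ?thesis
      proof (cases "J = J'")
        case True
        then have "link b w J" using b(3) J' by (simp add: link_def)
        then show ?thesis using b by blast
      next
        case False
        then have "z \<in> joints" using b(3) J' piece_inter_joint[of J J' z] by (simp add: link_def)
        then have z: "z \<in> B" using B(1) by blast
        then have "(x, z) \<in> ?R" using b(2) link_adj[OF b(3,1) z] by (rule_tac rtrancl_into_rtrancl)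
        then show ?thesis using J' z by blast
      qed
    qed
  qed simp
  then show ?thesis
  proof (elim disjE bexE exE conjE)
    fix b J assume "b \<in> B" "(x, b) \<in> ?R" "link b y J"
    then show ?thesis using link_adj B(3) by (metis rtrancl_into_rtrancl)
  qed simp
qed

section \<open>Merge levels as attained suprema\<close>

definition merge_level :: "('v, 'e) point \<Rightarrow> ('v, 'e) point \<Rightarrow> real" where
  "merge_level x y = Sup {d. joined {d..} x y}"

text \<open>The supremum is attained: slightly below it, a chain can be routed through joints, and
  no value of the distance function at the joints, \<open>x\<close> or \<open>y\<close> separates
  its level from the supremum, so the same chain works there.\<close>

lemma joined_iff_merge_level:
  assumes xy: "x \<in> points G" "y \<in> points G"
  shows "joined {d..} x y \<longleftrightarrow> d \<le> merge_level x y"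
proof -
  let ?M = "{d. joined {d..} x y}" and ?f = "gdist G s"
  obtain l where "gpath G x y l" using gpath_exists[OF G xy] by blast
  then have "joined {?f x - l..} x y" by (rule joined_gpath) simp
  then have ne: "?M \<noteq> {}" by blast
  have le: "d \<le> ?f x \<and> d \<le> ?f y" if "joined {d..} x y" for d
    using joined_level[OF that] by (simp add: level_def)
  then have bdd: "bdd_above ?M" by (intro bdd_aboveI[of _ "?f x"]) blast
  define d0 where "d0 = Sup ?M"
  have fin: "finite (joints \<union> {x, y})" using finite_joints by simp
  define V where "V = ?f ` (joints \<union> {x, y})"
  \<comment> \<open>The largest relevant value below the supremum \<open>d0\<close>; the element
    \<open>d0 - 1\<close> keeps the set nonempty.\<close>
  define v0 where "v0 = Max (insert (d0 - 1) {v \<in> V. v < d0})"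
  have finV: "finite (insert (d0 - 1) {v \<in> V. v < d0})" using fin by (simp add: V_def)
  then have v0: "v0 < d0" "\<And>v. v \<in> V \<Longrightarrow> v < d0 \<Longrightarrow> v \<le> v0"
    unfolding v0_def by (subst Max_less_iff, auto intro: Max_ge)
  obtain d' where d': "joined {d'..} x y" "v0 < d'"
    using less_cSupD[OF ne, of v0] v0(1) unfolding d0_def by blast
  have V: "v \<in> V \<Longrightarrow> d' \<le> v \<Longrightarrow> d0 \<le> v" for v
    using v0(2)[of v] d'(2) by linarith
  have "?f x \<in> V" "?f y \<in> V" by (auto simp: V_def)
  then have fxy: "d0 \<le> ?f x" "d0 \<le> ?f y" using V le[OF d'(1)] by auto
  have "(x, y) \<in> (adj {d'..})\<^sup>*"
    using d'(1) joined_level[OF d'(1)] joined_atLeast_iff_adj by blast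
  then have "(x, y) \<in> (adj {d'..} \<inter> (joints \<union> {x, y}) \<times> (joints \<union> {x, y}))\<^sup>*"
    by (intro adj_through_joints) auto
  moreover have "adj {d'..} \<inter> (joints \<union> {x, y}) \<times> (joints \<union> {x, y}) \<subseteq> adj {d0..}"
  proof (clarify)
    fix a b assume ab: "(a, b) \<in> adj {d'..}" "a \<in> joints \<union> {x, y}" "b \<in> joints \<union> {x, y}"
    then have "?f a \<in> V" "?f b \<in> V" unfolding V_def by (blast intro: imageI)+
    then show "(a, b) \<in> adj {d0..}" using ab(1) V[of "?f a"] V[of "?f b"] by (auto simp: adj_def)
  qed
  ultimately have "(x, y) \<in> (adj {d0..})\<^sup>*" using rtrancl_mono by blast
  then have d0: "joined {d0..} x y"
    using joined_atLeast_iff_adj[of x d0 y] xy(1) fxy(1) by (simp add: level_def)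
  show ?thesis
  proof
    assume "joined {d..} x y"
    then show "d \<le> merge_level x y" unfolding merge_level_def using bdd by (intro cSup_upper) auto
  next
    assume "d \<le> merge_level x y"
    then have "{d0..} \<subseteq> {d..}" by (simp add: merge_level_def d0_def)
    then show "joined {d..} x y" by (rule joined_mono[OF d0])
  qed
qed

text \<open>A chain visits finitely many points, all with values above \<open>d\<close>, so it
  already exists at some level \<open>a > d\<close>.\<close>

lemma joined_iff_merge_level_strict:
  assumes xy: "x \<in> points G" "y \<in> points G"
  shows "joined {d<..} x y \<longleftrightarrow> d < merge_level x y"
proof
  assume J: "joined {d<..} x y"
  then have x: "x \<in> level {d<..}" by (simp add: joined_level)
  have "(x, y) \<in> (adj {d<..})\<^sup>*"
    using J x joined_greaterThan_iff_adj by blast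
  then have "\<exists>a>d. joined {a..} x y"
  proof (induction rule: rtrancl_induct)
    case base
    show ?case using x by (intro exI[of _ "gdist G s x"] conjI joined_refl) (simp_all add: level_def)
  next
    case (step y z)
    from step.IH obtain a where a: "a > d" "joined {a..} x y" by blast
    define c where "c = min a (min (gdist G s y) (gdist G s z))"
    obtain J where J: "J \<in> pieces" "y \<in> J" "z \<in> J" "d < gdist G s y" "d < gdist G s z"
      using step.hyps(2) unfolding adj_def by auto
    have c: "c \<le> gdist G s y" "c \<le> gdist G s z" "d < c"
      using J(4,5) a(1) by (simp_all add: c_def)
    have "(y, z) \<in> adj {c..}" unfolding adj_def using J(1-3) c(1,2) by (simp, blast)
    then have "(y, z) \<in> (adj {c..})\<^sup>*" by simp
    moreover have "y \<in> level {c..}" using joined_level[OF a(2)] by (simp add: level_def c_def)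
    ultimately have "joined {c..} y z" using joined_atLeast_iff_adj by blast
    moreover have "joined {c..} x y" using a(2) by (rule joined_mono) (simp add: c_def)
    ultimately show ?case using c(3) by (intro exI[of _ c] conjI joined_trans[of _ x y z])
  qed
  then show "d < merge_level x y" using joined_iff_merge_level[OF xy] less_le_trans by blast
next
  assume "d < merge_level x y"
  then have "{merge_level x y..} \<subseteq> {d<..}" by auto
  moreover have "joined {merge_level x y..} x y" using joined_iff_merge_level[OF xy] by simp
  ultimately show "joined {d<..} x y" by (rule joined_mono[rotated])
qed

text \<open>Points are indexed through \<open>\<pi>\<close> so that pairs of a correspondence can
  index points of both graphs. The ultrametric inequality is transitivity of \<open>joined\<close>
  at the smaller level.\<close>

lemma merge_tree_gdist:
  assumes "finite Z" "\<pi> ` Z \<subseteq> points G"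
  shows "merge_tree Z (\<lambda>z. gdist G s (\<pi> z)) (\<lambda>y z. merge_level (\<pi> y) (\<pi> z))"
proof
  have iff: "joined {d..} (\<pi> x) (\<pi> y) \<longleftrightarrow> d \<le> merge_level (\<pi> x) (\<pi> y)" if "x \<in> Z" "y \<in> Z" for x y d
    using that assms(2) by (intro joined_iff_merge_level) auto
  show "merge_level (\<pi> x) (\<pi> y) = merge_level (\<pi> y) (\<pi> x)" if "x \<in> Z" "y \<in> Z" for x y
  proof (rule order_antisym)
    show "merge_level (\<pi> x) (\<pi> y) \<le> merge_level (\<pi> y) (\<pi> x)"
      by (subst iff[OF that(2,1), symmetric], rule joined_sym, subst iff[OF that], rule order_refl)
    show "merge_level (\<pi> y) (\<pi> x) \<le> merge_level (\<pi> x) (\<pi> y)"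
      by (subst iff[OF that, symmetric], rule joined_sym, subst iff[OF that(2,1)], rule order_refl)
  qed
  show "merge_level (\<pi> x) (\<pi> y) \<le> gdist G s (\<pi> x)" if "x \<in> Z" "y \<in> Z" for x y
    using iff[OF that, of "merge_level (\<pi> x) (\<pi> y)"] joined_level[of "{merge_level (\<pi> x) (\<pi> y)..}" "\<pi> x" "\<pi> y"]
    by (simp add: level_def)
  show "min (merge_level (\<pi> x) (\<pi> y)) (merge_level (\<pi> y) (\<pi> z)) \<le> merge_level (\<pi> x) (\<pi> z)" (is "?c \<le> _")
    if "x \<in> Z" "y \<in> Z" "z \<in> Z" for x y z
  proof -
    have "joined {?c..} (\<pi> x) (\<pi> y)" "joined {?c..} (\<pi> y) (\<pi> z)" using iff that by simp_all
    then have "joined {?c..} (\<pi> x) (\<pi> z)" by (rule joined_trans)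
    then show ?thesis using iff[OF that(1,3)] by simp
  qed
qed (use assms in simp)

end

subsection \<open>The persistence diagram as a list of bars\<close>

text \<open>
  A finite family of points is enough to compute the diagram once it contains a maximum of the
  distance function on every piece.
\<close>

locale peak_family = based_graph G s for G :: "('v, 'e) len_graph" and s +
  fixes Z :: "'z set" and \<pi> :: "'z \<Rightarrow> ('v, 'e) point"
  assumes finite_Z: "finite Z" and \<pi>: "\<And>z. z \<in> Z \<Longrightarrow> \<pi> z \<in> points G"
    and peaks: "\<And>J. J \<in> pieces \<Longrightarrow> \<exists>z\<in>Z. \<pi> z \<in> J \<and> (\<forall>x\<in>J. gdist G s x \<le> gdist G s (\<pi> z))"
begin

abbreviation comp :: "real set \<Rightarrow> ('v, 'e) point \<Rightarrow> ('v, 'e) point set" where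
  "comp U x \<equiv> Collect (joined U x)"

abbreviation comps :: "real set \<Rightarrow> ('v, 'e) point set set" where
  "comps U \<equiv> components_in G (level U)"

abbreviation f where "f \<equiv> gdist G s"

lemma comps_eq: "comps U = comp U ` level U"
  using level_subset
  by (simp add: components_in_def connected_components_of_def joined_def Int_absorb1)

lemma comp_eq_iff:
  assumes "x \<in> level U" "y \<in> level U"
  shows "comp U x = comp U y \<longleftrightarrow> joined U x y"
proof
  assume "comp U x = comp U y"
  moreover have "y \<in> comp U y" using joined_refl[OF assms(2)] by simp
  ultimately show "joined U x y" by blast
next
  assume xy: "joined U x y"
  show "comp U x = comp U y"
    using joined_trans[OF xy] joined_trans[OF joined_sym[OF xy]] by blast
qed

lemma comp_self: "x \<in> level U \<Longrightarrow> x \<in> comp U x"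
  by (simp add: joined_refl)

text \<open>The part of a piece inside an up-closed superlevel set is connected and contains the
  maximum of the piece.\<close>

lemma peak_above:
  assumes U: "\<forall>u\<in>U. \<forall>v\<ge>u. v \<in> U" and x: "x \<in> level U"
  shows "\<exists>z\<in>Z. joined U x (\<pi> z) \<and> f x \<le> f (\<pi> z)"
proof -
  obtain J where J: "J \<in> pieces" "x \<in> J" using x level_subset Union_pieces by blast
  obtain z where z: "z \<in> Z" "\<pi> z \<in> J" "f x \<le> f (\<pi> z)" using peaks[OF J(1)] J(2) by blast
  have fx: "f x \<in> U" using x by (simp add: level_def)
  let ?T = "{x \<in> J. f x \<in> U}"
  have "connectedin (gtopology G) ?T" using J(1) U by (intro connectedin_piece_superlevel) auto
  moreover have "?T \<subseteq> level U" using piece_subset[OF J(1)] by (auto simp: level_def)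
  ultimately have "joined U x (\<pi> z)"
    unfolding joined_iff_connectedin using J(2) z(2,3) fx U by (intro exI[of _ ?T] conjI) simp_all
  then show ?thesis using z(1,3) by blast
qed

text \<open>Every point of a component lies below a sampled maximum in the same component, so the
  supremum defining the birth is attained at one of finitely many sample points.\<close>

lemma birth_comp:
  assumes U: "\<forall>u\<in>U. \<forall>v\<ge>u. v \<in> U" and C: "C \<in> comps U"
  shows "\<exists>z\<in>Z. f (\<pi> z) \<in> U \<and> comp U (\<pi> z) = C \<and> birth f C = f (\<pi> z)"
    and "x \<in> C \<Longrightarrow> f x \<le> birth f C"
proof -
  obtain x0 where x0: "x0 \<in> level U" "C = comp U x0" using C comps_eq by auto
  define F where "F = {z \<in> Z. \<pi> z \<in> C}"
  have lev: "x \<in> level U" if "x \<in> C" for x using that x0(2) joined_level by blast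
  have above: "\<exists>z\<in>F. f x \<le> f (\<pi> z)" if x: "x \<in> C" for x
  proof -
    obtain z where z: "z \<in> Z" "joined U x (\<pi> z)" "f x \<le> f (\<pi> z)"
      using peak_above[OF U lev[OF x]] by blast
    have "joined U x0 x" using x x0(2) by simp
    then have "\<pi> z \<in> C" unfolding x0(2) using joined_trans[OF _ z(2)] by simp
    then show ?thesis using z unfolding F_def by blast
  qed
  have F: "finite F" "F \<noteq> {}"
  proof -
    show "finite F" using finite_Z by (simp add: F_def)
    have "x0 \<in> C" using comp_self[OF x0(1)] x0(2) by simp
    from above[OF this] show "F \<noteq> {}" by blast
  qed
  have "Max ((\<lambda>z. f (\<pi> z)) ` F) \<in> (\<lambda>z. f (\<pi> z)) ` F" using F by (intro Max_in) auto
  then obtain z where z: "z \<in> F" "f (\<pi> z) = Max ((\<lambda>z. f (\<pi> z)) ` F)" by (elim imageE) simp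
  have max: "f x \<le> f (\<pi> z)" if x: "x \<in> C" for x
  proof -
    obtain w where w: "w \<in> F" "f x \<le> f (\<pi> w)" using above[OF x] by blast
    have "f (\<pi> w) \<le> f (\<pi> z)" unfolding z(2) using F(1) w(1) by (intro Max_ge) auto
    then show ?thesis using w(2) by simp
  qed
  have zC: "z \<in> Z" "\<pi> z \<in> C" using z(1) by (auto simp: F_def)
  have b: "birth f C = f (\<pi> z)"
    unfolding birth_def
  proof (rule cSup_eq_maximum)
    show "f (\<pi> z) \<in> f ` C" using zC(2) by (rule imageI)
    show "v \<le> f (\<pi> z)" if "v \<in> f ` C" for v using that max by (elim imageE) simp
  qed
  have "joined U x0 (\<pi> z)" using zC(2) x0(2) by simp
  then have "comp U (\<pi> z) = C" using comp_eq_iff[OF x0(1) lev[OF zC(2)]] x0(2) by simp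
  moreover have "f (\<pi> z) \<in> U" using lev[OF zC(2)] by (simp add: level_def)
  ultimately show "\<exists>z\<in>Z. f (\<pi> z) \<in> U \<and> comp U (\<pi> z) = C \<and> birth f C = f (\<pi> z)" using zC(1) b by blast
  show "f x \<le> birth f C" if "x \<in> C" using max[OF that] b by simp
qed

lemma finite_comps:
  assumes U: "\<forall>u\<in>U. \<forall>v\<ge>u. v \<in> U"
  shows "finite (comps U)"
proof -
  have "comps U \<subseteq> (\<lambda>z. comp U (\<pi> z)) ` Z" using birth_comp(1)[OF U] by blast
  then show ?thesis using finite_Z by (meson finite_imageI finite_subset)
qed

definition \<mu> :: "'z \<Rightarrow> 'z \<Rightarrow> real" where
  "\<mu> y z = merge_level (\<pi> y) (\<pi> z)"

lemma merge_tree: "merge_tree Z (\<lambda>z. f (\<pi> z)) \<mu>"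
  unfolding \<mu>_def using finite_Z \<pi> by (intro merge_tree_gdist) auto

text \<open>The instance of \<open>card_elders\<close> in which \<open>\<kappa>\<close> takes
  topological components; attained merge levels make \<open>\<mu> y z \<in> U\<close> equivalent to
  being joined, for closed and for strict superlevel sets.\<close>

lemma card_elders_comps:
  assumes k: "ranking k Z (\<lambda>z. f (\<pi> z))" and U: "U = {d..} \<or> U = {d<..}" and b: "b \<in> U"
  shows "card (elders k Z (\<lambda>z. f (\<pi> z)) \<mu> U b) = card {C \<in> comps U. birth f C = b}"
proof -
  interpret T: merge_tree Z "\<lambda>z. f (\<pi> z)" \<mu> by (rule merge_tree)
  have up: "\<forall>u\<in>U. \<forall>v\<ge>u. v \<in> U" using U by auto
  have lev: "\<pi> z \<in> level U" if "z \<in> Z" "f (\<pi> z) \<in> U" for z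
    using that \<pi> by (simp add: level_def)
  have joined_iff: "joined U (\<pi> y) (\<pi> z) \<longleftrightarrow> \<mu> y z \<in> U" if "y \<in> Z" "z \<in> Z" for y z
    using U joined_iff_merge_level[OF \<pi> \<pi>, OF that]
      joined_iff_merge_level_strict[OF \<pi> \<pi>, OF that] by (auto simp: \<mu>_def)
  show ?thesis
  proof (rule card_elders[OF k finite_Z _ T.le_both b])
    show "v \<in> U" if "u \<in> U" "u \<le> v" for u v using up that by blast
    show "(\<lambda>z. comp U (\<pi> z)) ` {z \<in> Z. f (\<pi> z) \<in> U} = comps U"
    proof (intro subset_antisym subsetI)
      fix C assume "C \<in> (\<lambda>z. comp U (\<pi> z)) ` {z \<in> Z. f (\<pi> z) \<in> U}"
      then show "C \<in> comps U" unfolding comps_eq using lev by blast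
    next
      fix C assume "C \<in> comps U"
      from birth_comp(1)[OF up this] show "C \<in> (\<lambda>z. comp U (\<pi> z)) ` {z \<in> Z. f (\<pi> z) \<in> U}" by blast
    qed
    show "comp U (\<pi> y) = comp U (\<pi> z) \<longleftrightarrow> \<mu> y z \<in> U"
      if "y \<in> Z" "z \<in> Z" "f (\<pi> y) \<in> U" "f (\<pi> z) \<in> U" "y \<noteq> z" for y z
      using comp_eq_iff[OF lev lev, OF that(1,3,2,4)] joined_iff[OF that(1,2)] by simp
    show "f (\<pi> z) \<le> birth f (comp U (\<pi> z))" if "z \<in> Z" "f (\<pi> z) \<in> U" for z
    proof (rule birth_comp(2)[OF up])
      show "comp U (\<pi> z) \<in> comps U" using lev[OF that] comps_eq by blast
      show "\<pi> z \<in> comp U (\<pi> z)" using comp_self[OF lev[OF that]] .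
    qed
    show "\<exists>z\<in>Z. f (\<pi> z) \<in> U \<and> comp U (\<pi> z) = C \<and> birth f C = f (\<pi> z)" if "C \<in> comps U" for C
      using birth_comp(1)[OF up that] .
  qed
qed

lemma count_dying_births:
  "count (dying_births G f d K) b =
     card {C \<in> comps {d<..}. C \<subseteq> K \<and> birth f C = b} - (if birth f K = b then 1 else 0)"
proof -
  have "finite (comps {d<..})" by (rule finite_comps) simp
  moreover have "birth f -` {b} \<inter> {C \<in> comps {d<..}. C \<subseteq> K} =
      {C \<in> comps {d<..}. C \<subseteq> K \<and> birth f C = b}"
    by blast
  ultimately show ?thesis
    unfolding dying_births_def strict_superlevel_eq by (simp add: count_image_mset)
qed

text \<open>Each component present just before \<open>d\<close> lies in exactly one component at
  \<open>d\<close>. Summing over \<open>K\<close> therefore counts all those of birth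
  \<open>b\<close>, less one survivor for every \<open>K\<close> of birth \<open>b\<close>, which is
  the difference of elder counts found for bars.\<close>

lemma sum_count_dying_births:
  "(\<Sum>K\<in>comps {d..}. count (dying_births G f d K) b) =
     (if d < b then card {C \<in> comps {d<..}. birth f C = b} - card {K \<in> comps {d..}. birth f K = b} else 0)"
proof (cases "d < b")
  case False
  \<comment> \<open>Components present before \<open>d\<close> have births above \<open>d\<close>.
    For \<open>b \<le> d\<close> the minuend is thus 0, and truncated subtraction keeps 0 even if
    \<open>K\<close> has birth \<open>b\<close>.\<close>
  have "{C \<in> comps {d<..}. C \<subseteq> K \<and> birth f C = b} = {}" for K
  proof (rule equals0I)
    fix C assume C: "C \<in> {C \<in> comps {d<..}. C \<subseteq> K \<and> birth f C = b}"
    then obtain z where "f (\<pi> z) \<in> {d<..}" "birth f C = f (\<pi> z)"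
      using birth_comp(1)[of "{d<..}" C] by auto
    then show False using C False by simp
  qed
  then show ?thesis using False unfolding count_dying_births by (simp only: card.empty) simp
next
  case True
  define A where "A K = {C \<in> comps {d<..}. C \<subseteq> K \<and> birth f C = b}" for K
  have fin: "finite (comps {d<..})" "finite (comps {d..})" by (rule finite_comps; simp)+
  have ne: "\<exists>x\<in>level {d<..}. C = comp {d<..} x \<and> x \<in> C" if "C \<in> comps {d<..}" for C
    using that comp_self unfolding comps_eq by blast
  have sub: "comp {d<..} x \<subseteq> comp {d..} x" for x
  proof
    fix y assume "y \<in> comp {d<..} x"
    then have "joined {d<..} x y" by simp
    then have "joined {d..} x y" by (rule joined_mono) auto
    then show "y \<in> comp {d..} x" by simp
  qed
  have lev: "x \<in> level {d..}" if "x \<in> level {d<..}" for x using that by (simp add: level_def)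
  have same: "K = comp {d..} x" if K: "K \<in> comps {d..}" "x \<in> K" for K x
  proof -
    obtain y where y: "y \<in> level {d..}" "K = comp {d..} y" using K(1) comps_eq by auto
    then have "joined {d..} y x" using K(2) by simp
    then show ?thesis using comp_eq_iff[of y "{d..}" x] y joined_level by blast
  qed
  have Un: "(\<Union>K\<in>comps {d..}. A K) = {C \<in> comps {d<..}. birth f C = b}"
  proof (intro subset_antisym subsetI)
    fix C assume C: "C \<in> {C \<in> comps {d<..}. birth f C = b}"
    then obtain x where x: "x \<in> level {d<..}" "C = comp {d<..} x" using ne by blast
    have "comp {d..} x \<in> comps {d..}" using lev[OF x(1)] comps_eq by blast
    moreover have "C \<in> A (comp {d..} x)" using C sub[of x] unfolding A_def x(2) by simp
    ultimately show "C \<in> (\<Union>K\<in>comps {d..}. A K)" by (rule UN_I)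
  qed (auto simp: A_def)
  have disj: "A K \<inter> A K' = {}" if K: "K \<in> comps {d..}" "K' \<in> comps {d..}" "K \<noteq> K'" for K K'
  proof (rule equals0I)
    fix C assume C: "C \<in> A K \<inter> A K'"
    then obtain x where "x \<in> C" using ne[of C] by (auto simp: A_def)
    then have "x \<in> K" "x \<in> K'" using C by (auto simp: A_def)
    then have "K = comp {d..} x" "K' = comp {d..} x" using same K(1,2) by blast+
    then show False using K(3) by simp
  qed
  have finA: "finite (A K)" for K unfolding A_def using fin(1) by simp
  \<comment> \<open>Truncated subtraction commutes with the sum only if no term is cut off. If
    \<open>K\<close> has birth \<open>b > d\<close>, its highest sample point lies in a component
    present before \<open>d\<close>, and that component has birth \<open>b\<close> too.\<close>
  have le: "(if birth f K = b then 1 else 0) \<le> card (A K)" if K: "K \<in> comps {d..}" for K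
  proof (cases "birth f K = b")
    case bK: True
    obtain z where z: "z \<in> Z" "comp {d..} (\<pi> z) = K" "birth f K = f (\<pi> z)"
      using birth_comp(1)[of "{d..}" K] K by auto
    let ?C = "comp {d<..} (\<pi> z)"
    have zl: "\<pi> z \<in> level {d<..}" using \<pi>[OF z(1)] z(3) bK True by (simp add: level_def)
    then have C: "?C \<in> comps {d<..}" using comps_eq by blast
    have CK: "?C \<subseteq> K" using sub[of "\<pi> z"] z(2) by simp
    have "f (\<pi> z) \<le> birth f ?C"
      using birth_comp(2)[of "{d<..}" ?C "\<pi> z"] C comp_self[OF zl] by simp
    moreover obtain w where w: "comp {d<..} (\<pi> w) = ?C" "f (\<pi> w) \<in> {d<..}" "birth f ?C = f (\<pi> w)" "w \<in> Z"
      using birth_comp(1)[of "{d<..}" ?C] C by auto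
    moreover have "f (\<pi> w) \<le> birth f K"
    proof (rule birth_comp(2)[OF _ K])
      have "\<pi> w \<in> level {d<..}" using w \<pi> by (simp add: level_def)
      then show "\<pi> w \<in> K" using comp_self[of "\<pi> w" "{d<..}"] w(1) CK by blast
    qed simp
    ultimately have "birth f ?C = b" using z(3) bK by simp
    then have "?C \<in> A K" unfolding A_def using C CK by blast
    then have "card (A K) \<noteq> 0" using finA by auto
    then show ?thesis using bK by simp
  qed simp
  have "(\<Sum>K\<in>comps {d..}. count (dying_births G f d K) b) =
      (\<Sum>K\<in>comps {d..}. card (A K) - (if birth f K = b then 1 else 0))"
    unfolding count_dying_births A_def ..
  also have "\<dots> = (\<Sum>K\<in>comps {d..}. card (A K)) - (\<Sum>K\<in>comps {d..}. if birth f K = b then 1 else 0)"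
    using le by (rule sum_subtractf_nat)
  also have "(\<Sum>K\<in>comps {d..}. card (A K)) = card (\<Union>K\<in>comps {d..}. A K)"
    using fin(2) finA disj by (intro card_UN_disjoint[symmetric]) auto
  also have "(\<Sum>K\<in>comps {d..}. if birth f K = b then 1 else 0) = card {K \<in> comps {d..}. birth f K = b}"
    using fin(2) by (simp add: sum.If_cases Int_def)
  finally show ?thesis using True Un by simp
qed

text \<open>The multiplicity function of the diagram is identified with the \<open>count\<close> of
  an actual multiset, which also supplies the finite support that \<open>Abs_multiset\<close>
  expects.\<close>

theorem Dg0_eq_bars:
  assumes k: "ranking k Z (\<lambda>z. f (\<pi> z))"
  shows "Dg0 G f = filter_mset (\<lambda>(b, d). d < b) (bars k Z (\<lambda>z. f (\<pi> z)) \<mu>)"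
proof -
  interpret T: merge_tree Z "\<lambda>z. f (\<pi> z)" \<mu> by (rule merge_tree)
  have "(\<lambda>(b, d). \<Sum>K\<in>components_in G (superlevel G f d). count (dying_births G f d K) b) =
      count (filter_mset (\<lambda>(b, d). d < b) (bars k Z (\<lambda>z. f (\<pi> z)) \<mu>))"
  proof (intro ext, clarify)
    fix b d :: real
    have "card (elders k Z (\<lambda>z. f (\<pi> z)) \<mu> U b) = card {C \<in> comps U. birth f C = b}"
      if "U = {d..} \<or> U = {d<..}" "d < b" for U
      using k that(1) by (rule card_elders_comps) (use that in auto)
    then show "(\<Sum>K\<in>components_in G (superlevel G f d). count (dying_births G f d K) b) =
        count (filter_mset (\<lambda>(b, d). d < b) (bars k Z (\<lambda>z. f (\<pi> z)) \<mu>)) (b, d)"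
      unfolding superlevel_eq sum_count_dying_births by (simp add: T.count_bars)
  qed
  then show ?thesis unfolding Dg0_def by (simp only: count_inverse)
qed

text \<open>The bars missing from the diagram have length zero and can serve as padding in
  \<open>diag_matched\<close>.\<close>

lemma bars_eq_Dg0_plus_diagonal:
  assumes k: "ranking k Z (\<lambda>z. f (\<pi> z))"
  shows "\<exists>\<Delta>. set_mset \<Delta> \<subseteq> diagonal \<and> bars k Z (\<lambda>z. f (\<pi> z)) \<mu> = Dg0 G f + \<Delta>"
proof (intro exI conjI)
  interpret T: merge_tree Z "\<lambda>z. f (\<pi> z)" \<mu> by (rule merge_tree)
  let ?B = "bars k Z (\<lambda>z. f (\<pi> z)) \<mu>"
  show "?B = Dg0 G f + filter_mset (\<lambda>p. \<not> (case p of (b, d) \<Rightarrow> d < b)) ?B"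
    unfolding Dg0_eq_bars[OF k] by (rule multiset_partition)
  have "b = d" if "(b, d) \<in># ?B" "\<not> d < b" for b d
  proof (rule ccontr)
    assume "b \<noteq> d"
    then have "count ?B (b, d) = 0" unfolding T.count_bars using that(2) by simp
    then have "(b, d) \<notin># ?B" by (rule count_eq_zero_iff[THEN iffD1])
    then show False using that(1) by contradiction
  qed
  then show "set_mset (filter_mset (\<lambda>p. \<not> (case p of (b, d) \<Rightarrow> d < b)) ?B) \<subseteq> diagonal"
    unfolding diagonal_def by auto
qed

end

subsection \<open>Transporting connections along a correspondence\<close>

text \<open>The connected set \<open>T\<close> is traversed in steps shorter than
  \<open>\<epsilon>\<close>, each of which is carried over to the other graph.\<close>

lemma joined_correspondence:
  assumes "based_graph G1 s" "based_graph G2 t"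
    and M: "M \<subseteq> points G1 \<times> points G2" "fst ` M = points G1" "(s, t) \<in> M"
    and \<epsilon>: "0 < \<epsilon>"
    and dis: "\<And>x y x' y'. \<lbrakk>(x, y) \<in> M; (x', y') \<in> M\<rbrakk> \<Longrightarrow> \<bar>gdist G1 x x' - gdist G2 y y'\<bar> \<le> \<epsilon>"
    and xy: "(x, y) \<in> M" "(x', y') \<in> M" and J: "based_graph.joined G1 s {d..} x x'"
  shows "based_graph.joined G2 t {d - 3 * \<epsilon>..} y y'"
proof -
  interpret A: based_graph G1 s by fact
  interpret B: based_graph G2 t by fact
  \<comment> \<open>One \<open>\<epsilon>\<close> is lost between \<open>gdist G1 s z\<close> and
    \<open>gdist G2 t u\<close>, and less than \<open>2 * \<epsilon>\<close> along the path from
    \<open>u\<close> to \<open>u'\<close>. Since every point of \<open>T\<close> has height at least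
    \<open>d\<close>, the loss does not accumulate over steps.\<close>
  have step: "B.joined {d - 3 * \<epsilon>..} u u'"
    if z: "gdist G1 z z' < \<epsilon>" "(z, u) \<in> M" "(z', u') \<in> M" "d \<le> gdist G1 s z" for z z' u u'
  proof -
    have u: "u \<in> points G2" "u' \<in> points G2" using z M(1) by auto
    have "gdist G2 u u' < 2 * \<epsilon>" using dis[OF z(2,3)] z(1) by linarith
    then obtain l where l: "l < 2 * \<epsilon>" "gpath G2 u u' l" using B.gpath_less[OF u] by blast
    have "d - 3 * \<epsilon> \<le> gdist G2 t u - l" using dis[OF M(3) z(2)] z(4) l(1) by linarith
    then show ?thesis by (rule B.joined_gpath[OF l(2)])
  qed
  obtain T where T: "connectedin (gtopology G1) T" "T \<subseteq> A.level {d..}" "x \<in> T" "x' \<in> T"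
    using J unfolding A.joined_iff_connectedin by blast
  have T_points: "z \<in> points G1" and T_level: "d \<le> gdist G1 s z" if "z \<in> T" for z
    using T(2) that by (auto simp: A.level_def)
  have self: "gdist G1 z z < \<epsilon>" if "z \<in> T" for z using \<epsilon> T_points[OF that] by simp
  \<comment> \<open>The points of \<open>T\<close> with some partner joined to \<open>y\<close>.
    Being closed under short steps inside \<open>T\<close>, \<open>S\<close> has an
    \<open>\<epsilon>\<close>-neighbourhood disjoint on \<open>T\<close> from that of
    \<open>T - S\<close>, so connectedness forces \<open>S = T\<close>. A step from a point to
    itself changes its partner.\<close>
  define S where "S = {z \<in> T. \<exists>u. (z, u) \<in> M \<and> B.joined {d - 3 * \<epsilon>..} y u}"
  have S_step: "z' \<in> S" if z: "z \<in> S" "z' \<in> T" "gdist G1 z z' < \<epsilon>" for z z'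
  proof -
    obtain u where u: "(z, u) \<in> M" "B.joined {d - 3 * \<epsilon>..} y u" "z \<in> T"
      using z(1) by (auto simp: S_def)
    have "z' \<in> fst ` M" using T_points[OF z(2)] M(2) by simp
    then obtain u' where u': "(z', u') \<in> M" by force
    have "B.joined {d - 3 * \<epsilon>..} u u'" by (rule step[OF z(3) u(1) u' T_level[OF u(3)]])
    then have "B.joined {d - 3 * \<epsilon>..} y u'" using B.joined_trans[OF u(2)] by simp
    then show ?thesis using u' z(2) unfolding S_def by blast
  qed
  have "B.joined {d - 3 * \<epsilon>..} y y" by (rule step[OF self xy(1) xy(1)]) (use T(3) T_level in simp_all)
  then have "x \<in> S" using T(3) xy(1) unfolding S_def by blast
  have "x' \<in> S"
  proof (rule ccontr)
    assume "x' \<notin> S"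
    let ?E1 = "\<Union>z\<in>S. A.M.mball z \<epsilon>" and ?E2 = "\<Union>z\<in>T - S. A.M.mball z \<epsilon>"
    have "openin (gtopology G1) (A.M.mball z \<epsilon>)" for z
      using A.M.openin_mball unfolding A.mtopology_eq .
    then have "openin (gtopology G1) ?E1" "openin (gtopology G1) ?E2"
      by (auto intro!: openin_Union)
    moreover have "T \<subseteq> ?E1 \<union> ?E2"
    proof
      fix z assume z: "z \<in> T"
      then have "z \<in> A.M.mball z \<epsilon>" using T_points \<epsilon> by simp
      then show "z \<in> ?E1 \<union> ?E2" using z by blast
    qed
    moreover have "?E1 \<inter> ?E2 \<inter> T = {}"
    proof (rule equals0I)
      fix v assume v: "v \<in> ?E1 \<inter> ?E2 \<inter> T"
      then obtain z z' where z: "z \<in> S" "v \<in> A.M.mball z \<epsilon>" "z' \<in> T - S" "v \<in> A.M.mball z' \<epsilon>" by blast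
      have "v \<in> S" using S_step[OF z(1), of v] z(2) v by simp
      then have "z' \<in> S" using S_step[of v z'] z(3,4) by (simp add: A.M.commute)
      then show False using z(3) by simp
    qed
    moreover have "?E1 \<inter> T \<noteq> {}"
    proof -
      have "x \<in> A.M.mball x \<epsilon>" using T_points[OF T(3)] \<epsilon> by simp
      then show ?thesis using \<open>x \<in> S\<close> T(3) by blast
    qed
    moreover have "?E2 \<inter> T \<noteq> {}"
    proof -
      have "x' \<in> A.M.mball x' \<epsilon>" using T_points[OF T(4)] \<epsilon> by simp
      then show ?thesis using \<open>x' \<notin> S\<close> T(4) by blast
    qed
    ultimately show False by (rule connectedinD[OF T(1)])
  qed
  then obtain u where u: "(x', u) \<in> M" "B.joined {d - 3 * \<epsilon>..} y u" by (auto simp: S_def)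
  have "B.joined {d - 3 * \<epsilon>..} u y'" by (rule step[OF self u(1) xy(2)]) (use T(4) T_level in simp_all)
  then show ?thesis by (rule B.joined_trans[OF u(2)])
qed

lemma merge_level_correspondence:
  assumes "based_graph G1 s" "based_graph G2 t"
    and "M \<subseteq> points G1 \<times> points G2" "fst ` M = points G1" "(s, t) \<in> M" "0 < \<epsilon>"
    and "\<And>x y x' y'. \<lbrakk>(x, y) \<in> M; (x', y') \<in> M\<rbrakk> \<Longrightarrow> \<bar>gdist G1 x x' - gdist G2 y y'\<bar> \<le> \<epsilon>"
    and xy: "(x, y) \<in> M" "(x', y') \<in> M"
  shows "based_graph.merge_level G1 s x x' - 3 * \<epsilon> \<le> based_graph.merge_level G2 t y y'"
proof -
  interpret A: based_graph G1 s by fact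
  interpret B: based_graph G2 t by fact
  have p: "x \<in> points G1" "x' \<in> points G1" "y \<in> points G2" "y' \<in> points G2" using assms(3) xy by auto
  have J: "A.joined {A.merge_level x x'..} x x'" using A.joined_iff_merge_level[OF p(1,2)] by simp
  have "B.joined {A.merge_level x x' - 3 * \<epsilon>..} y y'"
    by (rule joined_correspondence[OF assms(1-6) _ xy J]) (rule assms(7))
  then show ?thesis using B.joined_iff_merge_level[OF p(3,4)] by simp
qed

lemma bottleneck_dist_correspondence:
  fixes G1 :: "('v1, 'e1) len_graph" and G2 :: "('v2, 'e2) len_graph"
  assumes G: "metric_graph G1" "metric_graph G2"
    and M: "correspondence (points G1) (points G2) M" and st: "(s, t) \<in> M"
    and \<epsilon>: "0 < \<epsilon>"
    and dis: "\<And>x y x' y'. \<lbrakk>(x, y) \<in> M; (x', y') \<in> M\<rbrakk> \<Longrightarrow> \<bar>gdist G1 x x' - gdist G2 y y'\<bar> \<le> \<epsilon>"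
  shows "bottleneck_dist (Dg0 G1 (gdist G1 s)) (Dg0 G2 (gdist G2 t)) \<le> 3 * \<epsilon>"
proof -
  have M': "M \<subseteq> points G1 \<times> points G2" "fst ` M = points G1" "snd ` M = points G2"
    using M unfolding correspondence_def by simp_all
  have s: "s \<in> points G1" and t: "t \<in> points G2" using M'(1) st by auto
  interpret A: based_graph G1 s using G(1) s by unfold_locales
  interpret B: based_graph G2 t using G(2) t by unfold_locales
  \<comment> \<open>Surjectivity of the projections lifts a maximum on each piece of either graph to
    a pair of \<open>M\<close>.\<close>
  have "\<forall>J\<in>A.pieces. \<exists>z\<in>M. fst z \<in> J \<and> (\<forall>x\<in>J. gdist G1 s x \<le> gdist G1 s (fst z))"
  proof
    fix J assume J: "J \<in> A.pieces"
    obtain p where p: "p \<in> J" "\<forall>x\<in>J. gdist G1 s x \<le> gdist G1 s p" using A.piece_peak[OF J] by blast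
    have "p \<in> fst ` M" using A.piece_subset[OF J] p(1) M'(2) by blast
    then show "\<exists>z\<in>M. fst z \<in> J \<and> (\<forall>x\<in>J. gdist G1 s x \<le> gdist G1 s (fst z))" using p by force
  qed
  then obtain za where za: "\<And>J. J \<in> A.pieces \<Longrightarrow> za J \<in> M"
    "\<And>J. J \<in> A.pieces \<Longrightarrow> fst (za J) \<in> J \<and> (\<forall>x\<in>J. gdist G1 s x \<le> gdist G1 s (fst (za J)))"
    by metis
  have "\<forall>J\<in>B.pieces. \<exists>z\<in>M. snd z \<in> J \<and> (\<forall>x\<in>J. gdist G2 t x \<le> gdist G2 t (snd z))"
  proof
    fix J assume J: "J \<in> B.pieces"
    obtain p where p: "p \<in> J" "\<forall>x\<in>J. gdist G2 t x \<le> gdist G2 t p" using B.piece_peak[OF J] by blast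
    have "p \<in> snd ` M" using B.piece_subset[OF J] p(1) M'(3) by blast
    then show "\<exists>z\<in>M. snd z \<in> J \<and> (\<forall>x\<in>J. gdist G2 t x \<le> gdist G2 t (snd z))" using p by force
  qed
  then obtain zb where zb: "\<And>J. J \<in> B.pieces \<Longrightarrow> zb J \<in> M"
    "\<And>J. J \<in> B.pieces \<Longrightarrow> snd (zb J) \<in> J \<and> (\<forall>x\<in>J. gdist G2 t x \<le> gdist G2 t (snd (zb J)))"
    by metis
  define Z where "Z = za ` A.pieces \<union> zb ` B.pieces"
  have ZM: "Z \<subseteq> M" using za(1) zb(1) unfolding Z_def by blast
  have finZ: "finite Z" using A.finite_pieces B.finite_pieces by (simp add: Z_def)
  have Zp: "fst z \<in> points G1" "snd z \<in> points G2" if "z \<in> Z" for z using that ZM M'(1) by auto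
  interpret PA: peak_family G1 s Z fst
  proof unfold_locales
    show "\<exists>z\<in>Z. fst z \<in> J \<and> (\<forall>x\<in>J. gdist G1 s x \<le> gdist G1 s (fst z))" if "J \<in> A.pieces" for J
      using za(2)[OF that] that unfolding Z_def by blast
  qed (use finZ Zp in simp_all)
  interpret PB: peak_family G2 t Z snd
  proof unfold_locales
    show "\<exists>z\<in>Z. snd z \<in> J \<and> (\<forall>x\<in>J. gdist G2 t x \<le> gdist G2 t (snd z))" if "J \<in> B.pieces" for J
      using zb(2)[OF that] that unfolding Z_def by blast
  qed (use finZ Zp in simp_all)
  obtain k where k: "ranking k Z (\<lambda>z. gdist G1 s (fst z))" using exists_ranking[OF finZ] by blast
  obtain k' where k': "ranking k' Z (\<lambda>z. gdist G2 t (snd z))" using exists_ranking[OF finZ] by blast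
  have births: "\<bar>gdist G1 s (fst z) - gdist G2 t (snd z)\<bar> \<le> \<epsilon>" if "z \<in> Z" for z
    using dis[OF st, of "fst z" "snd z"] that ZM by auto
  \<comment> \<open>The converse correspondence yields the opposite inequality between the merge
    levels.\<close>
  have conv: "M\<inverse> \<subseteq> points G2 \<times> points G1" "fst ` (M\<inverse>) = points G2" "(t, s) \<in> M\<inverse>"
    using M'(1,3) st by force+
  have dis': "\<bar>gdist G2 y y' - gdist G1 x x'\<bar> \<le> \<epsilon>" if "(y, x) \<in> M\<inverse>" "(y', x') \<in> M\<inverse>" for x y x' y'
    using dis[of x y x' y'] that by (simp add: abs_minus_commute)
  have levels: "\<bar>PA.\<mu> z w - PB.\<mu> z w\<bar> \<le> 3 * \<epsilon>" if zw: "z \<in> Z" "w \<in> Z" for z w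
  proof -
    have m: "(fst z, snd z) \<in> M" "(fst w, snd w) \<in> M" using zw ZM by auto
    then have m': "(snd z, fst z) \<in> M\<inverse>" "(snd w, fst w) \<in> M\<inverse>" by simp_all
    have "PA.\<mu> z w - 3 * \<epsilon> \<le> PB.\<mu> z w"
      unfolding PA.\<mu>_def PB.\<mu>_def
      by (rule merge_level_correspondence[OF A.based_graph_axioms B.based_graph_axioms M'(1,2) st \<epsilon> dis m])
    moreover have "PB.\<mu> z w - 3 * \<epsilon> \<le> PA.\<mu> z w"
      unfolding PA.\<mu>_def PB.\<mu>_def
      by (rule merge_level_correspondence[OF B.based_graph_axioms A.based_graph_axioms conv \<epsilon> dis' m'])
    ultimately show ?thesis by linarith
  qed
  obtain \<Delta> where \<Delta>: "set_mset \<Delta> \<subseteq> diagonal"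
    "bars k Z (\<lambda>z. gdist G1 s (fst z)) PA.\<mu> = Dg0 G1 (gdist G1 s) + \<Delta>"
    using PA.bars_eq_Dg0_plus_diagonal[OF k] by blast
  obtain \<Delta>' where \<Delta>': "set_mset \<Delta>' \<subseteq> diagonal"
    "bars k' Z (\<lambda>z. gdist G2 t (snd z)) PB.\<mu> = Dg0 G2 (gdist G2 t) + \<Delta>'"
    using PB.bars_eq_Dg0_plus_diagonal[OF k'] by blast
  have "rel_mset (\<lambda>p q. \<bar>fst p - fst q\<bar> \<le> \<epsilon> \<and> \<bar>snd p - snd q\<bar> \<le> 3 * \<epsilon>)
      (Dg0 G1 (gdist G1 s) + \<Delta>) (Dg0 G2 (gdist G2 t) + \<Delta>')"
    unfolding \<Delta>(2)[symmetric] \<Delta>'(2)[symmetric]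
    by (rule bars_stable[OF PA.merge_tree PB.merge_tree births levels k k'])
  then have "rel_mset (\<lambda>p q. linf_dist p q \<le> 3 * \<epsilon>)
      (Dg0 G1 (gdist G1 s) + \<Delta>) (Dg0 G2 (gdist G2 t) + \<Delta>')"
    by (rule multiset.rel_mono_strong) (use \<epsilon> in \<open>simp add: linf_dist_def\<close>)
  then have "diag_matched (3 * \<epsilon>) (Dg0 G1 (gdist G1 s)) (Dg0 G2 (gdist G2 t))"
    unfolding diag_matched_def using \<Delta>(1) \<Delta>'(1) by blast
  then show ?thesis using \<epsilon> by (intro bottleneck_dist_le) simp_all
qed

subsection \<open>Persistence distortion and Gromov-Hausdorff distance\<close>

lemma points_nonempty:
  assumes "metric_graph G"
  shows "points G \<noteq> {}"
  using assms unfolding metric_graph_def Digraph_Component.connected_def strongly_connected_def points_def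
  by auto

text \<open>The maxima on the finitely many pieces bound the distance from \<open>s\<close>; the
  triangle inequality through \<open>s\<close> doubles the bound.\<close>

lemma gdist_bounded:
  assumes G: "metric_graph G"
  shows "\<exists>D. \<forall>x\<in>points G. \<forall>y\<in>points G. gdist G x y \<le> D"
proof -
  obtain s where s: "s \<in> points G" using points_nonempty[OF G] by blast
  interpret based_graph G s using G s by unfold_locales
  obtain p where p: "\<And>J x. J \<in> pieces \<Longrightarrow> x \<in> J \<Longrightarrow> gdist G s x \<le> gdist G s (p J)"
    using piece_peak by metis
  define D where "D = Max ((\<lambda>J. gdist G s (p J)) ` pieces)"
  have D: "gdist G s x \<le> D" if x: "x \<in> points G" for x
  proof -
    obtain J where J: "J \<in> pieces" "x \<in> J" using x Union_pieces by blast
    have "gdist G s (p J) \<le> D" unfolding D_def using finite_pieces J(1) by (intro Max_ge) auto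
    then show ?thesis using p[OF J] by simp
  qed
  have "gdist G x y \<le> 2 * D" if "x \<in> points G" "y \<in> points G" for x y
    using M.triangle''[OF that(1) s that(2)] D[OF that(1)] D[OF that(2)] by simp
  then show ?thesis by blast
qed

lemma gdist_diff_bounded:
  assumes "metric_graph G1" "metric_graph G2"
  shows "\<exists>K>0. \<forall>x\<in>points G1. \<forall>x'\<in>points G1. \<forall>y\<in>points G2. \<forall>y'\<in>points G2.
    \<bar>gdist G1 x x' - gdist G2 y y'\<bar> \<le> K"
proof -
  obtain D where D: "\<forall>x\<in>points G1. \<forall>y\<in>points G1. gdist G1 x y \<le> D" using gdist_bounded[OF assms(1)] by blast
  obtain E where E: "\<forall>x\<in>points G2. \<forall>y\<in>points G2. gdist G2 x y \<le> E" using gdist_bounded[OF assms(2)] by blast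
  interpret A: Metric_space "points G1" "gdist G1" by (rule Metric_space_gdist[OF assms(1)])
  interpret B: Metric_space "points G2" "gdist G2" by (rule Metric_space_gdist[OF assms(2)])
  \<comment> \<open>The summand 1 makes the bound strictly positive, so that it can be used as the
    \<open>\<epsilon>\<close> of \<open>bottleneck_dist_correspondence\<close>.\<close>
  show ?thesis
  proof (intro exI[of _ "\<bar>D\<bar> + \<bar>E\<bar> + 1"] conjI ballI)
    fix x x' y y' assume "x \<in> points G1" "x' \<in> points G1" "y \<in> points G2" "y' \<in> points G2"
    then have "gdist G1 x x' \<le> D" "gdist G2 y y' \<le> E" using D E by blast+
    then show "\<bar>gdist G1 x x' - gdist G2 y y'\<bar> \<le> \<bar>D\<bar> + \<bar>E\<bar> + 1"
      using A.nonneg[of x x'] B.nonneg[of y y'] by linarith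
  qed simp
qed

lemma correspondence_Times:
  assumes "X \<noteq> {}" "Y \<noteq> {}"
  shows "correspondence X Y (X \<times> Y)"
  using assms by (simp add: correspondence_def)

lemma le_distortion:
  assumes G: "metric_graph G1" "metric_graph G2"
    and M: "correspondence (points G1) (points G2) M" "(x, y) \<in> M" "(x', y') \<in> M"
  shows "\<bar>gdist G1 x x' - gdist G2 y y'\<bar> \<le> distortion (gdist G1) (gdist G2) M"
proof -
  obtain K where K: "\<forall>x\<in>points G1. \<forall>x'\<in>points G1. \<forall>y\<in>points G2. \<forall>y'\<in>points G2.
    \<bar>gdist G1 x x' - gdist G2 y y'\<bar> \<le> K" using gdist_diff_bounded[OF G] by blast
  have "M \<subseteq> points G1 \<times> points G2" using M(1) by (simp add: correspondence_def)
  then have "bdd_above {\<bar>gdist G1 x1 x2 - gdist G2 y1 y2\<bar> | x1 y1 x2 y2. (x1, y1) \<in> M \<and> (x2, y2) \<in> M}"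
    using K by (intro bdd_aboveI[of _ K]) blast
  then show ?thesis unfolding distortion_def using M(2,3) by (intro cSup_upper) blast+
qed

text \<open>The full product is a correspondence of finite distortion containing every pair of
  basepoints, which gives one bound for all diagrams, as the Hausdorff triangle inequality
  requires.\<close>

lemma bottleneck_dist_bounded:
  assumes G: "metric_graph G1" "metric_graph G2"
  shows "\<exists>K. \<forall>P\<in>dist_diagrams G1. \<forall>Q\<in>dist_diagrams G2. bottleneck_dist P Q \<le> K"
proof -
  obtain K where K: "K > 0" "\<forall>x\<in>points G1. \<forall>x'\<in>points G1. \<forall>y\<in>points G2. \<forall>y'\<in>points G2.
    \<bar>gdist G1 x x' - gdist G2 y y'\<bar> \<le> K" using gdist_diff_bounded[OF G] by blast
  have C: "correspondence (points G1) (points G2) (points G1 \<times> points G2)"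
    using points_nonempty[OF G(1)] points_nonempty[OF G(2)] by (rule correspondence_Times)
  have "bottleneck_dist (Dg0 G1 (gdist G1 s)) (Dg0 G2 (gdist G2 t)) \<le> 3 * K"
    if "s \<in> points G1" "t \<in> points G2" for s t
    by (rule bottleneck_dist_correspondence[OF G C _ K(1)]) (use K(2) that in auto)
  then show ?thesis unfolding dist_diagrams_def by blast
qed

lemma dist_diagrams_nonempty: "metric_graph G \<Longrightarrow> dist_diagrams G \<noteq> {}"
  using points_nonempty[of G] unfolding dist_diagrams_def by blast

lemma d_PD_le_distortion:
  assumes G: "metric_graph G1" "metric_graph G2"
    and M: "correspondence (points G1) (points G2) M"
  shows "d_PD G1 G2 \<le> 3 * distortion (gdist G1) (gdist G2) M"
proof (rule field_le_epsilon)
  fix e :: real assume e: "e > 0"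
  let ?D = "distortion (gdist G1) (gdist G2) M"
  have M': "fst ` M = points G1" "snd ` M = points G2" using M by (simp_all add: correspondence_def)
  \<comment> \<open>The slack keeps \<open>\<epsilon>\<close> positive when the distortion is 0 and
    amounts to \<open>e\<close> after multiplication by 3.\<close>
  define \<epsilon> where "\<epsilon> = ?D + e / 3"
  have dis: "\<bar>gdist G1 x x' - gdist G2 y y'\<bar> \<le> \<epsilon>" if "(x, y) \<in> M" "(x', y') \<in> M" for x y x' y'
    using le_distortion[OF G M that] e by (simp add: \<epsilon>_def)
  obtain s t where "(s, t) \<in> M" using M' points_nonempty[OF G(1)] by fastforce
  then have "0 \<le> ?D" using le_distortion[OF G M] abs_ge_zero order_trans by blast
  then have \<epsilon>: "\<epsilon> > 0" using e by (simp add: \<epsilon>_def)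
  have le: "bottleneck_dist (Dg0 G1 (gdist G1 s)) (Dg0 G2 (gdist G2 t)) \<le> 3 * ?D + e" if "(s, t) \<in> M" for s t
    using bottleneck_dist_correspondence[OF G M that \<epsilon> dis] by (simp add: \<epsilon>_def)
  show "d_PD G1 G2 \<le> 3 * ?D + e"
    unfolding d_PD_def
  proof (rule hausdorff_dist_le[OF dist_diagrams_nonempty[OF G(1)] dist_diagrams_nonempty[OF G(2)]
        bottleneck_dist_nonneg])
    fix P assume "P \<in> dist_diagrams G1"
    then obtain s where s: "s \<in> points G1" "P = Dg0 G1 (gdist G1 s)" unfolding dist_diagrams_def by blast
    have "s \<in> fst ` M" using s(1) M'(1) by simp
    then obtain t where t: "(s, t) \<in> M" by force
    then have "t \<in> points G2" using M'(2) by force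
    then show "\<exists>Q\<in>dist_diagrams G2. bottleneck_dist P Q \<le> 3 * ?D + e"
      using le[OF t] s(2) unfolding dist_diagrams_def by blast
  next
    fix Q assume "Q \<in> dist_diagrams G2"
    then obtain t where t: "t \<in> points G2" "Q = Dg0 G2 (gdist G2 t)" unfolding dist_diagrams_def by blast
    have "t \<in> snd ` M" using t(1) M'(2) by simp
    then obtain s where s: "(s, t) \<in> M" by force
    then have "s \<in> points G1" using M'(1) by force
    then show "\<exists>P\<in>dist_diagrams G1. bottleneck_dist P Q \<le> 3 * ?D + e"
      using le[OF s] t(2) unfolding dist_diagrams_def by blast
  qed
qed

lemma d_PD_le_d_GH:
  assumes G: "metric_graph G1" "metric_graph G2"
  shows "d_PD G1 G2 \<le> 6 * d_GH G1 G2"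
proof -
  have "{M. correspondence (points G1) (points G2) M} \<noteq> {}"
    using correspondence_Times[OF points_nonempty[OF G(1)] points_nonempty[OF G(2)]] by blast
  moreover have "d_PD G1 G2 / 3 \<le> distortion (gdist G1) (gdist G2) M"
    if "M \<in> {M. correspondence (points G1) (points G2) M}" for M
    using d_PD_le_distortion[OF G, of M] that by simp
  ultimately have "d_PD G1 G2 / 3 \<le>
      (INF M\<in>{M. correspondence (points G1) (points G2) M}. distortion (gdist G1) (gdist G2) M)"
    by (rule cINF_greatest)
  \<comment> \<open>The factor 1/2 in the Gromov-Hausdorff distance turns 3 into 6.\<close>
  then show ?thesis unfolding d_GH_def GH_dist_def by simp
qed

lemma d_PD_commute: "d_PD G1 G2 = d_PD G2 G1"
  unfolding d_PD_def by (rule hausdorff_dist_commute) (rule bottleneck_dist_commute)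

lemma d_PD_triangle:
  assumes G: "metric_graph G1" "metric_graph G2" "metric_graph G3"
  shows "d_PD G1 G3 \<le> d_PD G1 G2 + d_PD G2 G3"
proof -
  obtain K where K: "\<forall>P\<in>dist_diagrams G1. \<forall>Q\<in>dist_diagrams G2. bottleneck_dist P Q \<le> K"
    using bottleneck_dist_bounded[OF G(1,2)] by blast
  obtain L where L: "\<forall>P\<in>dist_diagrams G2. \<forall>Q\<in>dist_diagrams G3. bottleneck_dist P Q \<le> L"
    using bottleneck_dist_bounded[OF G(2,3)] by blast
  show ?thesis
    unfolding d_PD_def
  proof (rule hausdorff_dist_triangle[of _ _ _ _ "max K L"])
    show "bottleneck_dist P Q \<le> max K L" if "P \<in> dist_diagrams G1" "Q \<in> dist_diagrams G2" for P Q
      using K that by (simp add: le_max_iff_disj)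
    show "bottleneck_dist P Q \<le> max K L" if "P \<in> dist_diagrams G2" "Q \<in> dist_diagrams G3" for P Q
      using L that by (simp add: le_max_iff_disj)
  qed (rule dist_diagrams_nonempty G bottleneck_dist_nonneg bottleneck_dist_triangle)+
qed

theorem theorem3:
  fixes G1 :: "('v1, 'e1) len_graph" and G2 :: "('v2, 'e2) len_graph"
  assumes "metric_graph G1" and "metric_graph G2"
  shows "d_PD G1 G2 \<le> 6 * d_GH G1 G2 \<and>
    (\<forall>(G1' :: ('v3, 'e3) len_graph) (G2' :: ('v4, 'e4) len_graph).
       metric_graph G1' \<longrightarrow> metric_graph G2' \<longrightarrow>
       d_PD G1' G2' \<le> d_PD G1 G2 + 6 * d_GH G1 G1' + 6 * d_GH G2 G2')"
proof (intro conjI allI impI)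
  show "d_PD G1 G2 \<le> 6 * d_GH G1 G2" by (rule d_PD_le_d_GH[OF assms])
  fix G1' :: "('v3, 'e3) len_graph" and G2' :: "('v4, 'e4) len_graph"
  assume G': "metric_graph G1'" "metric_graph G2'"
  have "d_PD G1' G2' \<le> d_PD G1' G1 + d_PD G1 G2'"
    by (rule d_PD_triangle[OF G'(1) assms(1) G'(2)])
  moreover have "d_PD G1 G2' \<le> d_PD G1 G2 + d_PD G2 G2'"
    by (rule d_PD_triangle[OF assms G'(2)])
  moreover have "d_PD G1' G1 \<le> 6 * d_GH G1 G1'"
    using d_PD_le_d_GH[OF assms(1) G'(1)] by (subst d_PD_commute)
  moreover have "d_PD G2 G2' \<le> 6 * d_GH G2 G2'" by (rule d_PD_le_d_GH[OF assms(2) G'(2)])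
  ultimately show "d_PD G1' G2' \<le> d_PD G1 G2 + 6 * d_GH G1 G1' + 6 * d_GH G2 G2'" by linarith
qed

end
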